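(* Let $G$ be an odd unicyclic graph on the vertex set $[n]=\{1,\dots,n\}$. Let $\{e_{\{i,j\}} : \{i,j\}\in E(G)\}$ denote the standard basis of $S^{n}$. Then the first syzygy of $L_G$ is minimally generated by elements of the form (a) $g_{i,j}e_{\{k,l\}}-g_{k,l}e_{\{i,j\}}$, where $\{i,j\}\neq\{k,l\}\in E(G)$, and (b) $(-1)^{p_A(v)}f_{z,w}e_{\{u,v\}}+(-1)^{p_A(z)}f_{v,w}e_{\{u,z\}}+(-1)^{p_A(w)}f_{v,z}e_{\{u,w\}}$, where $A=\{u,v,w,z\}$ forms a claw in $G$ with center $u$.
   Context: Let $\mathbb{K}$ be any field and $S=\mathbb{K}[x_1,\dots,x_n,y_1,\dots,y_n]$. For $i<j$ put $g_{i,j}=x_ix_j+y_iy_j$ and $f_{i,j}=x_iy_j-x_jy_i$; the subscripts of $f$ and $g$ stand for the unordered pair, taken in increasing order. For a finite simple graph $G$ on $[n]$, the Lovász-Saks-Schrijver (LSS) ideal is $L_G=(g_{i,j} : \{i,j\}\in E(G))\subset S$. The first syzygy of $L_G$ is the kernel of the $S$-linear map from the free module with basis $\{e_{\{i,j\}}:\{i,j\}\in E(G)\}$ to $L_G$ sending $e_{\{i,j\}}$ to $g_{i,j}$. A unicyclic graph is a graph containing exactly one cycle; it is odd unicyclic if its girth (the length of that cycle) is odd. A claw $\{u,v,w,z\}$ with center $u$ is the graph with vertices $u,v,w,z$ and edges $\{u,v\},\{u,w\},\{u,z\}$; the set $\{u,v,w,z\}$ forms a claw in $G$ with center $u$ if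 $v,w,z$ are three distinct neighbours of $u$ in $G$. For $A\subseteq[n]$ and $i\in A$, $p_A(i)=|\{j\in A : j\le i\}|$.
   Formalization: In (b) the positions are counted among the three leaves, p_{A\{u}}, instead of p_A: with p_A the element is not a syzygy when the center u lies between the leaves and char K ≠ 2 (edges 12, 23, 24, 34, center 2); otherwise both agree up to an overall sign. *)

theory Defs
  imports Complex_Main "HOL-Library.Poly_Mapping" "HOL-Library.Function_Algebras"
begin

text \<open>
  The vertex set $[n]$ is rendered as an arbitrary finite, linearly ordered type \<open>'v\<close>, with
  $n$ its number of elements; of the labels $1, \dots, n$ only the order is ever used.
\<close>

section \<open>Odd unicyclic graphs\<close>

definition simple_graph :: "'v set set \<Rightarrow> bool"
  where "simple_graph E \<longleftrightarrow> (\<forall>d\<in>E. card d = 2)"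

definition closed_walk_edges :: "'v list \<Rightarrow> 'v set set"
  where "closed_walk_edges vs =
    (\<lambda>i. {vs ! i, vs ! (Suc i mod length vs)}) ` {..<length vs}"

text \<open>
  A cycle is a subgraph, identified with its edge set \<open>C\<close>, so that rotating or reversing the list
  of its vertices does not give a new cycle. Its length is \<open>card C\<close>.
\<close>

definition is_cycle :: "'v set set \<Rightarrow> 'v set set \<Rightarrow> bool"
  where "is_cycle E C \<longleftrightarrow>
    C \<subseteq> E \<and> (\<exists>vs. distinct vs \<and> length vs \<ge> 3 \<and> C = closed_walk_edges vs)"

definition unicyclic :: "'v set set \<Rightarrow> bool"
  where "unicyclic E \<longleftrightarrow> simple_graph E \<and> (\<exists>!C. is_cycle E C)"

definition odd_unicyclic :: "'v set set \<Rightarrow> bool"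
  where "odd_unicyclic E \<longleftrightarrow> unicyclic E \<and> odd (card (THE C. is_cycle E C))"

definition is_claw :: "'v set set \<Rightarrow> 'v \<Rightarrow> 'v \<Rightarrow> 'v \<Rightarrow> 'v \<Rightarrow> bool"
  where "is_claw E u v w z \<longleftrightarrow>
    v \<noteq> w \<and> v \<noteq> z \<and> w \<noteq> z \<and> {u, v} \<in> E \<and> {u, w} \<in> E \<and> {u, z} \<in> E"


section \<open>The polynomial ring and the forms $f$ and $g$\<close>

datatype 'v indet = X 'v | Y 'v

text \<open>Polynomials as finitely supported coefficient functions on monomials (exponent vectors).\<close>

type_synonym ('v, 'k) lss_ring = "('v indet \<Rightarrow>\<^sub>0 nat) \<Rightarrow>\<^sub>0 'k"

definition indet :: "'v indet \<Rightarrow> ('v, 'k::field) lss_ring"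
  where "indet t = Poly_Mapping.single (Poly_Mapping.single t 1) 1"

abbreviation x_var :: "'v \<Rightarrow> ('v, 'k::field) lss_ring" where "x_var i \<equiv> indet (X i)"
abbreviation y_var :: "'v \<Rightarrow> ('v, 'k::field) lss_ring" where "y_var i \<equiv> indet (Y i)"

text \<open>The index of $f$ and $g$ is a set \<open>{i, j}\<close>, read in increasing order.\<close>

definition g_poly :: "'v::{finite,linorder} set \<Rightarrow> ('v, 'k::field) lss_ring"
  where "g_poly d = x_var (Min d) * x_var (Max d) + y_var (Min d) * y_var (Max d)"

definition f_poly :: "'v::{finite,linorder} set \<Rightarrow> ('v, 'k::field) lss_ring"
  where "f_poly d = x_var (Min d) * y_var (Max d) - x_var (Max d) * y_var (Min d)"


section \<open>The free module on the edges and the first syzygy\<close>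

text \<open>
  The free module with basis indexed by \<open>E\<close> consists of the functions on pairs of vertices that
  vanish outside \<open>E\<close>.
\<close>

definition scale ::
    "('v, 'k::field) lss_ring \<Rightarrow> ('v set \<Rightarrow> ('v, 'k) lss_ring) \<Rightarrow>
     ('v set \<Rightarrow> ('v, 'k) lss_ring)"
  where "scale r c = (\<lambda>d. r * c d)"

interpretation edge_module: module "scale :: ('v, 'k::field) lss_ring \<Rightarrow> _"
  by unfold_locales (auto simp: scale_def algebra_simps)

definition edge_basis :: "'v set \<Rightarrow> ('v set \<Rightarrow> ('v, 'k::field) lss_ring)"
  where "edge_basis d = (\<lambda>d'. if d' = d then 1 else 0)"

definition first_syzygy ::
    "'v::{finite,linorder} set set \<Rightarrow> ('v set \<Rightarrow> ('v, 'k::field) lss_ring) set"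
  where "first_syzygy E = {c. (\<forall>d. d \<notin> E \<longrightarrow> c d = 0) \<and> (\<Sum>d\<in>E. c d * g_poly d) = 0}"

definition minimally_generates ::
    "('v set \<Rightarrow> ('v, 'k::field) lss_ring) set \<Rightarrow> ('v set \<Rightarrow> ('v, 'k) lss_ring) set \<Rightarrow> bool"
  where "minimally_generates B N \<longleftrightarrow>
    edge_module.span B = N \<and> (\<forall>B'. B' \<subset> B \<longrightarrow> edge_module.span B' \<noteq> N)"


section \<open>The two families of generators\<close>

definition koszul ::
    "'v::{finite,linorder} set \<Rightarrow> 'v set \<Rightarrow> ('v set \<Rightarrow> ('v, 'k::field) lss_ring)"
  where "koszul d d' = scale (g_poly d) (edge_basis d') - scale (g_poly d') (edge_basis d)"

text \<open>
  Exchanging \<open>d\<close> and \<open>d'\<close> negates \<open>koszul d d'\<close>, so a minimal generating set contains only one of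
  the two. The relation \<open>R\<close> selects one ordering of each unordered pair of distinct edges.
\<close>

definition selects_orders :: "('a \<times> 'a) set \<Rightarrow> 'a set \<Rightarrow> bool"
  where "selects_orders R E \<longleftrightarrow>
    (\<forall>d\<in>E. \<forall>d'\<in>E. d \<noteq> d' \<longrightarrow> ((d, d') \<in> R \<longleftrightarrow> (d', d) \<notin> R))"

definition koszul_syzygies ::
    "('v::{finite,linorder} set \<times> 'v set) set \<Rightarrow> 'v set set \<Rightarrow>
     ('v set \<Rightarrow> ('v, 'k::field) lss_ring) set"
  where "koszul_syzygies R E =
    {koszul d d' | d d'. d \<in> E \<and> d' \<in> E \<and> d \<noteq> d' \<and> (d, d') \<in> R}"

definition position :: "'v::{finite,linorder} set \<Rightarrow> 'v \<Rightarrow> nat"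
  where "position A i = card {j\<in>A. j \<le> i}"

definition claw_combination ::
    "'v::{finite,linorder} set \<Rightarrow> 'v \<Rightarrow> 'v \<Rightarrow> 'v \<Rightarrow> 'v \<Rightarrow>
     ('v set \<Rightarrow> ('v, 'k::field) lss_ring)"
  where "claw_combination A u v w z =
      scale ((- 1) ^ position A v * f_poly {z, w}) (edge_basis {u, v})
    + scale ((- 1) ^ position A z * f_poly {v, w}) (edge_basis {u, z})
    + scale ((- 1) ^ position A w * f_poly {v, z}) (edge_basis {u, w})"

text \<open>
  The signs are those of the identity
  $\det(w,z)\,v - \det(v,z)\,w + \det(v,w)\,z = 0$ in the plane (for $v < w < z$), so positions
  have to be counted among the three leaves only. Counting them in \<open>{u, v, w, z}\<close> gives the same
  element up to sign when \<open>u\<close> is smaller or larger than all leaves; otherwise the result is not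
  a syzygy in characteristic other than 2, as \<open>claw_identity_fails_with_center_counted\<close> below
  shows for $v < u < w < z$.
  The element depends only on \<open>u\<close> and on the set of leaves, not on the order of \<open>v, w, z\<close>.
\<close>

definition claw_syzygies ::
    "'v::{finite,linorder} set set \<Rightarrow> ('v set \<Rightarrow> ('v, 'k::field) lss_ring) set"
  where "claw_syzygies E =
    {claw_combination ({u, v, w, z} - {u}) u v w z | u v w z. is_claw E u v w z}"

lemma g_pair: "g_poly {i, j} = x_var i * x_var j + y_var i * y_var j"
  by (cases "i \<le> j") (auto simp: g_poly_def min_def max_def mult.commute)

lemma f_pair: "i \<le> j \<Longrightarrow> f_poly {i, j} = x_var i * y_var j - x_var j * y_var i"
  by (simp add: f_poly_def min_def max_def)

lemma claw_identity:
  fixes u v w z :: "'v::{finite,linorder}"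
  assumes "v < w" "w < z" "u \<notin> {v, w, z}"
  defines "A \<equiv> {u, v, w, z} - {u}"
  shows "(- 1) ^ position A v * f_poly {z, w} * g_poly {u, v}
    + (- 1) ^ position A z * f_poly {v, w} * g_poly {u, z}
    + (- 1) ^ position A w * f_poly {v, z} * g_poly {u, w}
    = (0 :: ('v, 'k::field) lss_ring)"
proof -
  have "{j\<in>A. j \<le> v} = {v}" "{j\<in>A. j \<le> w} = {v, w}" "{j\<in>A. j \<le> z} = {v, w, z}"
    using assms(1-3) by (auto simp: A_def)
  then have pos: "position A v = 1" "position A w = 2" "position A z = 3"
    using assms(1-2) by (auto simp: position_def)
  have fzw: "f_poly {z, w} = (x_var w * y_var z - x_var z * y_var w :: ('v, 'k) lss_ring)"
    using \<open>w < z\<close> by (subst insert_commute) (simp add: f_pair)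
  show ?thesis
    using assms(1-2) by (simp add: f_pair g_pair fzw pos) (simp add: algebra_simps)
qed

lemma claw_identity_fails_with_center_counted:
  fixes u v w z :: "'v::{finite,linorder}"
  assumes "v < u" "u < w" "w < z"
  defines "A \<equiv> {u, v, w, z}"
  shows "(- 1) ^ position A v * f_poly {z, w} * g_poly {u, v}
    + (- 1) ^ position A z * f_poly {v, w} * g_poly {u, z}
    + (- 1) ^ position A w * f_poly {v, z} * g_poly {u, w}
    = - (2 * f_poly {w, z} * g_poly {u, v} :: ('v, 'k::field) lss_ring)"
proof -
  have "{j\<in>A. j \<le> v} = {v}" "{j\<in>A. j \<le> w} = {v, u, w}" "{j\<in>A. j \<le> z} = {v, u, w, z}"
    using assms(1-3) by (auto simp: A_def)
  moreover have "v \<noteq> u" "v \<noteq> w" "v \<noteq> z" "u \<noteq> w" "u \<noteq> z" "w \<noteq> z"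
    using assms(1-3) by auto
  ultimately have pos: "position A v = 1" "position A w = 3" "position A z = 4"
    by (simp_all add: position_def)
  have fzw: "f_poly {z, w} = (x_var w * y_var z - x_var z * y_var w :: ('v, 'k) lss_ring)"
    using \<open>w < z\<close> by (subst insert_commute) (simp add: f_pair)
  show ?thesis
    using assms(1-3) by (simp add: f_pair g_pair fzw pos) (simp add: algebra_simps)
qed

end

theory Submission
  imports Defs "HOL-Library.Product_Lexorder"
begin

text \<open>
  Add the edges one at a time. The syzygies of \<open>F \<union> {{u, v}}\<close> are generated as claimed as soon as those
  of \<open>F\<close> are and the colon ideal of the ideal of \<open>F\<close> by $g_{u,v}$ is generated by the ideal of \<open>F\<close> and
  the $f_{i,j}$ with $i, j$ both adjacent to \<open>u\<close> or both adjacent to \<open>v\<close>: the first kind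
  of generators lifts to Koszul syzygies, the second kind to claws. Removing a suitable edge \<open>{u, v}\<close> of the odd cycle
  leaves a forest, in which \<open>u\<close> and \<open>v\<close> have the same colour; so every edge added
  either joins two components of a 2-coloured forest or is this last edge.

  Rotating the vectors $(x_i, y_i)$ of one colour class turns the ideal of a forest into the ideal
  of minors of a graph $r$. Completing the neighbourhood of a vertex \<open>w\<close>, respectively setting the vector of
  \<open>w\<close> to zero, gives two larger ideals whose intersection is the original one. Repeating
  this leads to disjoint unions of complete graphs, whose ideals are kernels of explicit maps to a domain.
  If the neighbourhoods of \<open>u\<close> and \<open>v\<close> are already complete, neither of the two vertices is ever killed,
  so $g_{u,v}$, or the minor of \<open>u\<close> and \<open>v\<close> in different components, is not a zero divisor;
  this yields the colon ideal.

  All generators are quadratic, and each of them has a monomial in some coordinate that no other generator has,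
  so none can be omitted.
\<close>

section \<open>Substitution homomorphisms\<close>

text \<open>The ring as a module over itself, so \<open>ideal.span B\<close> is the ideal generated
  by \<open>B\<close>.\<close>

interpretation ideal: module "(*) :: 'a::comm_ring_1 \<Rightarrow> 'a \<Rightarrow> 'a"
  by unfold_locales (auto simp: algebra_simps)

declare ideal.scale_scale [simp del]

instance indet :: (finite) finite
proof
  have "(UNIV :: 'a indet set) = range X \<union> range Y"
    by (metis UNIV_eq_I UnCI indet.exhaust rangeI)
  then show "finite (UNIV :: 'a indet set)"
    by (metis finite_UnI finite_UNIV finite_imageI)
qed

lemma sum_UNIV_indet:
  "(\<Sum>t\<in>UNIV. F t) = (\<Sum>i\<in>UNIV. F (X i)) + (\<Sum>i\<in>UNIV. F (Y (i::'v::finite)))"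
proof -
  have "(UNIV :: 'v indet set) = range X \<union> range Y"
    by (metis UNIV_eq_I UnCI indet.exhaust rangeI)
  then have "sum F UNIV = sum F (range X) + sum F (range Y)"
    by (metis (no_types, lifting) sum.union_disjoint finite_UNIV finite_imageI disjoint_iff
        imageE indet.distinct(1))
  then show ?thesis
    by (simp add: sum.reindex inj_def)
qed

lemma poly_mapping_induct_single_add:
  assumes "\<And>m c. P (Poly_Mapping.single m c)"
    and "\<And>p q. P p \<Longrightarrow> P q \<Longrightarrow> P (p + q)"
  shows "P (p :: 'a \<Rightarrow>\<^sub>0 'b::comm_monoid_add)"
proof (induction p rule: Poly_Mapping.update_induct)
  case const
  show ?case
    using assms(1)[of undefined 0] by simp
next
  case (update p m c)
  have "Poly_Mapping.update m c p = Poly_Mapping.single m c + p"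
    using update(1)
    by (intro poly_mapping_eqI)
      (auto simp: lookup_update lookup_add lookup_single when_def in_keys_iff)
  then show ?case
    using assms update by simp
qed

definition power_prod :: "('a::finite \<Rightarrow> 'r::comm_ring_1) \<Rightarrow> ('a \<Rightarrow>\<^sub>0 nat) \<Rightarrow> 'r"
  where "power_prod \<rho> m = (\<Prod>t\<in>UNIV. \<rho> t ^ Poly_Mapping.lookup m t)"

lemma power_prod_add: "power_prod \<rho> (m + n) = power_prod \<rho> m * power_prod \<rho> n"
  by (simp add: power_prod_def lookup_add power_add prod.distrib)

lemma power_prod_0 [simp]: "power_prod \<rho> 0 = 1"
  by (simp add: power_prod_def)

lemma power_prod_single: "power_prod \<rho> (Poly_Mapping.single t n) = \<rho> t ^ n"
proof -
  have "power_prod \<rho> (Poly_Mapping.single t n) = (\<Prod>s\<in>UNIV. if s = t then \<rho> t ^ n else 1)"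
    unfolding power_prod_def by (intro prod.cong) (auto simp: lookup_single when_def)
  then show ?thesis
    by simp
qed

text \<open>Evaluation homomorphism. The exponent monoid of the target is left open because the map
  serves both for endomorphisms of the ring and for parametrizations with values in a polynomial
  ring in other variables.\<close>

definition subst ::
    "('v::finite indet \<Rightarrow> ('b::comm_monoid_add \<Rightarrow>\<^sub>0 'k::field)) \<Rightarrow> ('v, 'k) lss_ring \<Rightarrow> ('b \<Rightarrow>\<^sub>0 'k)"
  where "subst \<rho> p = (\<Sum>m\<in>Poly_Mapping.keys p. Poly_Mapping.single 0 (Poly_Mapping.lookup p m) * power_prod \<rho> m)"

lemma subst_single: "subst \<rho> (Poly_Mapping.single m c) = Poly_Mapping.single 0 c * power_prod \<rho> m"
  by (simp add: subst_def)

lemma subst_add: "subst \<rho> (p + q) = subst \<rho> p + subst \<rho> q"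
  unfolding subst_def
  by (rule setsum_keys_plus_distrib) (simp_all add: single_add algebra_simps)

lemma subst_0 [simp]: "subst \<rho> 0 = 0"
  by (simp add: subst_def)

lemma subst_uminus: "subst \<rho> (- p) = - subst \<rho> p"
  by (metis add.right_inverse add_eq_0_iff subst_0 subst_add)

lemma subst_diff: "subst \<rho> (p - q) = subst \<rho> p - subst \<rho> q"
  by (metis add_uminus_conv_diff subst_add subst_uminus)

lemma subst_mult:
  fixes \<rho> :: "'v::finite indet \<Rightarrow> ('b::comm_monoid_add \<Rightarrow>\<^sub>0 'k::field)"
  shows "subst \<rho> (p * q) = subst \<rho> p * subst \<rho> q"
proof (induction p rule: poly_mapping_induct_single_add)
  case (1 m c)
  show ?case
  proof (induction q rule: poly_mapping_induct_single_add)
    case (1 n d)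
    have prod: "subst \<rho> (Poly_Mapping.single m c * Poly_Mapping.single n d)
        = Poly_Mapping.single 0 (c * d) * (power_prod \<rho> m * power_prod \<rho> n)"
      by (simp add: mult_single subst_single power_prod_add)
    have const: "Poly_Mapping.single (0 :: 'b) (c * d) = Poly_Mapping.single 0 c * Poly_Mapping.single 0 d"
      by (simp add: mult_single)
    show ?case
      unfolding prod const subst_single by (simp only: ac_simps)
  qed (simp add: subst_add algebra_simps)
qed (simp add: subst_add algebra_simps)

lemma subst_indet [simp]: "subst \<rho> (indet t) = \<rho> t"
  by (simp add: indet_def subst_single power_prod_single)

lemma indet_power: "indet t ^ n = (Poly_Mapping.single (Poly_Mapping.single t n) 1 :: ('v, 'k::field) lss_ring)"
proof (induction n)
  case (Suc n)
  have "Poly_Mapping.single t (Suc n) = Poly_Mapping.single t 1 + Poly_Mapping.single t n"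
    by (simp flip: single_add)
  with Suc show ?case
    by (simp add: indet_def mult_single)
qed simp

lemma power_prod_indet:
  "power_prod indet m = (Poly_Mapping.single m 1 :: ('v::finite, 'k::field) lss_ring)"
  by (induction m rule: poly_mapping_induct_single_add)
    (simp_all add: power_prod_single indet_power power_prod_add mult_single)

text \<open>The constants and the indeterminates generate the ring as an algebra, so properties
  stable under sums and products need a check only there.\<close>

lemma lss_ring_induct [case_names const indet add mult]:
  assumes "\<And>c. P (Poly_Mapping.single 0 c)" and "\<And>t. P (indet t)"
    and add: "\<And>p q. P p \<Longrightarrow> P q \<Longrightarrow> P (p + q)" and mult: "\<And>p q. P p \<Longrightarrow> P q \<Longrightarrow> P (p * q)"
  shows "P (p :: ('v::finite, 'k::field) lss_ring)"
proof (induction p rule: poly_mapping_induct_single_add)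
  case (1 m c)
  have one: "P 1"
    using assms(1)[of 1] by simp
  have "P (indet t ^ n)" for t n
    by (induction n) (auto intro: one assms)
  then have "P (\<Prod>t\<in>A. indet t ^ Poly_Mapping.lookup m t)" for A
    by (induction A rule: infinite_finite_induct) (auto intro: one mult)
  then have "P (power_prod indet m)"
    by (simp add: power_prod_def)
  then have "P (Poly_Mapping.single 0 c * Poly_Mapping.single m 1)"
    unfolding power_prod_indet by (intro mult assms(1))
  then show ?case
    by (simp add: mult_single)
qed (rule add)

lemma subst_const [simp]: "subst \<rho> (Poly_Mapping.single 0 c) = Poly_Mapping.single 0 c"
  by (simp add: subst_single)

lemma subst_inverse:
  assumes "\<And>t. subst \<rho> (\<rho>' t) = indet t"
  shows "subst \<rho> (subst \<rho>' p) = p"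
  by (induction p rule: lss_ring_induct) (simp_all add: assms subst_add subst_mult)

text \<open>The polynomials congruent to their image modulo the ideal form a subalgebra, since
  \<open>p * q - p' * q' = q * (p - p') + p' * (q - q')\<close>.\<close>

lemma diff_subst_in_span:
  assumes "\<And>t. indet t - \<rho> t \<in> ideal.span B"
  shows "p - subst \<rho> p \<in> ideal.span B"
proof (induction p rule: lss_ring_induct)
  case (const c)
  then show ?case by (simp add: ideal.span_zero)
next
  case (indet t)
  then show ?case by (simp add: assms)
next
  case (add p q)
  then have "(p - subst \<rho> p) + (q - subst \<rho> q) \<in> ideal.span B"
    by (rule ideal.span_add)
  then show ?case by (simp add: subst_add algebra_simps)
next
  case (mult p q)
  then have "q * (p - subst \<rho> p) + subst \<rho> p * (q - subst \<rho> q) \<in> ideal.span B"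
    by (intro ideal.span_add ideal.span_scale)
  then show ?case by (simp add: subst_mult algebra_simps)
qed

lemma subst_span:
  assumes "p \<in> ideal.span B" and "\<And>b. b \<in> B \<Longrightarrow> subst \<rho> b \<in> ideal.span B'"
  shows "subst \<rho> p \<in> ideal.span B'"
  using assms(1)
  by (induction rule: ideal.span_induct_alt)
    (auto simp: subst_add subst_mult intro: ideal.span_zero ideal.span_add ideal.span_scale assms(2))

lemma mult_span:
  assumes "p \<in> ideal.span B" and "\<And>b. b \<in> B \<Longrightarrow> b * h \<in> ideal.span B'"
  shows "p * h \<in> ideal.span B'"
  using assms(1)
proof (induction rule: ideal.span_induct_alt)
  case base
  then show ?case by (simp add: ideal.span_zero)
next
  case (step c b p)
  then have "c * (b * h) + p * h \<in> ideal.span B'"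
    by (simp add: assms(2) ideal.span_add ideal.span_scale)
  then show ?case by (simp add: algebra_simps)
qed

section \<open>Ideals of minors of a graph\<close>

definition minor :: "'v \<Rightarrow> 'v \<Rightarrow> ('v, 'k::field) lss_ring"
  where "minor i j = x_var i * y_var j - x_var j * y_var i"

lemma minor_refl [simp]: "minor i i = 0"
  by (simp add: minor_def)

text \<open>The generators of the binomial edge ideal of \<open>r\<close>, together with the
  variables of the killed vertices \<open>W\<close>. A reflexive \<open>r\<close> contributes only
  zero minors in addition.\<close>

definition graph_generators :: "'v set \<Rightarrow> ('v \<Rightarrow> 'v \<Rightarrow> bool) \<Rightarrow> ('v, 'k::field) lss_ring set"
  where "graph_generators W r = x_var ` W \<union> y_var ` W \<union> {minor i j | i j. r i j}"

abbreviation graph_ideal :: "'v set \<Rightarrow> ('v \<Rightarrow> 'v \<Rightarrow> bool) \<Rightarrow> ('v, 'k::field) lss_ring set"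
  where "graph_ideal W r \<equiv> ideal.span (graph_generators W r)"

lemma graph_generatorsE:
  assumes "b \<in> graph_generators W r"
  obtains i where "i \<in> W" "b = x_var i" | i where "i \<in> W" "b = y_var i"
    | i j where "r i j" "b = minor i j"
  using assms by (auto simp: graph_generators_def)

lemma graph_ideal_x: "i \<in> W \<Longrightarrow> x_var i \<in> graph_ideal W r"
  and graph_ideal_y: "i \<in> W \<Longrightarrow> y_var i \<in> graph_ideal W r"
  and graph_ideal_minor: "r i j \<Longrightarrow> minor i j \<in> graph_ideal W r"
  by (auto simp: graph_generators_def intro!: ideal.span_base)

section \<open>Completing neighbourhoods and splitting off a vertex\<close>

definition closed_at :: "('v \<Rightarrow> 'v \<Rightarrow> bool) \<Rightarrow> 'v \<Rightarrow> bool"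
  where "closed_at r w \<longleftrightarrow> (\<forall>i j. r w i \<longrightarrow> r w j \<longrightarrow> r i j)"

definition complete_at :: "('v \<Rightarrow> 'v \<Rightarrow> bool) \<Rightarrow> 'v \<Rightarrow> 'v \<Rightarrow> 'v \<Rightarrow> bool"
  where "complete_at r w = (\<lambda>i j. r i j \<or> (r w i \<and> r w j))"

lemma reflp_complete_at: "reflp r \<Longrightarrow> reflp (complete_at r w)"
  by (auto simp: complete_at_def reflp_def)

lemma symp_complete_at: "symp r \<Longrightarrow> symp (complete_at r w)"
  by (auto simp: complete_at_def symp_def)

lemma closed_at_complete_at:
  assumes "reflp r" "symp r"
  shows "closed_at (complete_at r w) w"
  using assms unfolding closed_at_def complete_at_def reflp_def symp_def by blast

text \<open>If \<open>u\<close> is not adjacent to \<open>w\<close>, its neighbourhood does not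
  change. Otherwise closedness at \<open>u\<close> puts all neighbours of \<open>u\<close> among
  those of \<open>w\<close>, where every pair becomes adjacent.\<close>

lemma closed_at_complete_at_other:
  assumes "symp r" "closed_at r u"
  shows "closed_at (complete_at r w) u"
  using assms unfolding closed_at_def complete_at_def symp_def by blast

text \<open>Every new edge joins two neighbours of \<open>w\<close>, which are already connected
  through \<open>w\<close>.\<close>

lemma rtranclp_complete_at:
  assumes "symp r"
  shows "(complete_at r w)\<^sup>*\<^sup>* = r\<^sup>*\<^sup>*"
proof (rule rtranclp_subset)
  show "r \<le> complete_at r w"
    by (auto simp: complete_at_def)
  show "complete_at r w \<le> r\<^sup>*\<^sup>*"
  proof (intro le_funI le_boolI)
    fix i j assume "complete_at r w i j"
    then consider "r i j" | "r i w" "r w j"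
      using assms by (auto simp: complete_at_def symp_def)
    then show "r\<^sup>*\<^sup>* i j"
      by cases (auto intro: converse_rtranclp_into_rtranclp)
  qed
qed

text \<open>Let \<epsilon> kill the two variables of \<open>w\<close>. Modulo the original ideal,
  every element of the completed ideal agrees with its image under \<epsilon>, and \<epsilon> maps
  the ideal with \<open>w\<close> killed into the original one. Hence an element \<open>h\<close> of
  both lies in the original ideal.\<close>

lemma graph_ideal_decompose:
  fixes h :: "('v::finite, 'k::field) lss_ring"
  assumes r: "reflp r" "symp r"
    and h1: "h \<in> graph_ideal W (complete_at r w)" and h2: "h \<in> graph_ideal (insert w W) r"
  shows "h \<in> graph_ideal W r"
proof -
  let ?I = "graph_ideal W r :: ('v, 'k) lss_ring set"
  define \<epsilon> :: "('v, 'k) lss_ring \<Rightarrow> ('v, 'k) lss_ring"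
    where "\<epsilon> = subst (\<lambda>t. if t = X w \<or> t = Y w then 0 else indet t)"
  have minor: "\<epsilon> (minor i j) = (if i = w \<or> j = w then 0 else minor i j)" for i j
    by (simp add: \<epsilon>_def minor_def subst_diff subst_mult)
  have \<epsilon>_span: "\<epsilon> p \<in> ?I" if "p \<in> graph_ideal (insert w W) r" for p
    unfolding \<epsilon>_def
  proof (rule subst_span[OF that], fold \<epsilon>_def)
    fix b :: "('v, 'k) lss_ring" assume "b \<in> graph_generators (insert w W) r"
    then show "\<epsilon> b \<in> ?I"
    proof (cases rule: graph_generatorsE)
      case (3 i j)
      then show ?thesis
        by (simp add: minor graph_ideal_minor ideal.span_zero)
    qed (auto simp: \<epsilon>_def graph_ideal_x graph_ideal_y ideal.span_zero)
  qed
  have I_le: "?I \<subseteq> graph_ideal (insert w W) r"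
    by (rule ideal.span_mono) (auto simp: graph_generators_def)
  \<comment> \<open>The two conditions on products with the variables of \<open>w\<close> make
    \<open>T\<close> closed under multiplication: \<open>a - \<epsilon> a\<close> is a combination
    of these variables, so its product with \<open>p\<close> stays in the ideal.\<close>
  define T where "T = {p. p - \<epsilon> p \<in> ?I \<and> x_var w * p \<in> ?I \<and> y_var w * p \<in> ?I}"
  have "ideal.subspace T"
  proof (rule ideal.subspaceI)
    show "0 \<in> T"
      by (simp add: T_def \<epsilon>_def ideal.span_zero)
  next
    fix p q assume "p \<in> T" "q \<in> T"
    moreover have "p + q - \<epsilon> (p + q) = (p - \<epsilon> p) + (q - \<epsilon> q)"
      by (simp add: \<epsilon>_def subst_add)
    ultimately show "p + q \<in> T"
      by (simp only: T_def mem_Collect_eq distrib_left ideal.span_add)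
  next
    fix a p assume p: "p \<in> T"
    have "a - \<epsilon> a \<in> ideal.span {x_var w, y_var w}"
      unfolding \<epsilon>_def by (rule diff_subst_in_span) (auto intro: ideal.span_base ideal.span_zero)
    then have "(a - \<epsilon> a) * p \<in> ?I"
      by (rule mult_span) (use p in \<open>auto simp: T_def\<close>)
    moreover have "\<epsilon> a * (p - \<epsilon> p) \<in> ?I"
      using p by (auto simp: T_def intro: ideal.span_scale)
    moreover have "a * p - \<epsilon> (a * p) = (a - \<epsilon> a) * p + \<epsilon> a * (p - \<epsilon> p)"
      by (simp add: \<epsilon>_def subst_mult algebra_simps)
    ultimately have "a * p - \<epsilon> (a * p) \<in> ?I"
      by (simp only: ideal.span_add)
    moreover have "a * (x_var w * p) \<in> ?I" "a * (y_var w * p) \<in> ?I"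
      using p by (simp_all add: T_def ideal.span_scale)
    ultimately show "a * p \<in> T"
      by (simp add: T_def mult.left_commute)
  qed
  moreover have "graph_generators W (complete_at r w) \<subseteq> T"
  proof
    fix b :: "('v, 'k) lss_ring" assume "b \<in> graph_generators W (complete_at r w)"
    then consider "b \<in> graph_generators W r" | i j where "b = minor i j" "r w i" "r w j"
      by (auto simp: graph_generators_def complete_at_def)
    then show "b \<in> T"
    proof cases
      case 1
      then have b: "b \<in> ?I"
        by (rule ideal.span_base)
      then have "\<epsilon> b \<in> ?I"
        using I_le \<epsilon>_span by blast
      with b show ?thesis
        by (simp add: T_def ideal.span_diff ideal.span_scale)
    next
      case 2
      \<comment> \<open>If \<open>i\<close> or \<open>j\<close> is \<open>w\<close>, the image is
        zero and the minor itself is a generator; otherwise \<epsilon> fixes the minor. The two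
        identities below are Pluecker relations.\<close>
      have "minor i j - \<epsilon> (minor i j) \<in> ?I"
        using 2 r by (auto simp: minor symp_def intro: ideal.span_zero graph_ideal_minor)
      moreover have "x_var w * minor i j = x_var i * minor w j - x_var j * (minor w i :: ('v, 'k) lss_ring)"
        and "y_var w * minor i j = y_var i * minor w j - y_var j * (minor w i :: ('v, 'k) lss_ring)"
        by (simp_all add: minor_def algebra_simps)
      moreover have "minor w i \<in> ?I" "minor w j \<in> ?I"
        using 2 by (auto intro: graph_ideal_minor)
      ultimately show ?thesis
        using 2 by (simp add: T_def ideal.span_diff ideal.span_scale)
    qed
  qed
  ultimately have "graph_ideal W (complete_at r w) \<subseteq> T"
    by (simp add: ideal.span_minimal)
  with h1 have "h - \<epsilon> h \<in> ?I"
    by (auto simp: T_def)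
  then have "(h - \<epsilon> h) + \<epsilon> h \<in> ?I"
    using \<epsilon>_span[OF h2] by (rule ideal.span_add)
  then show ?thesis
    by simp
qed

section \<open>Generic points of graph ideals\<close>

text \<open>Two monomials with the same degree at every vertex and the same \<open>X\<close>-degree
  in every class are connected by moves replacing \<open>x_i y_j\<close> by \<open>x_j y_i\<close>
  with \<open>i\<close>, \<open>j\<close> in one class. Each move adds a multiple of a minor. The
  induction is on the total excess of the \<open>X\<close>-exponents of \<open>m\<close> over those
  of \<open>m'\<close>.\<close>

lemma single_diff_in_graph_ideal:
  fixes m m' :: "'v::finite indet \<Rightarrow>\<^sub>0 nat"
  assumes s: "\<And>i j. s i = s j \<Longrightarrow> r i j"
    and deg: "\<And>i. Poly_Mapping.lookup m (X i) + Poly_Mapping.lookup m (Y i)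
      = Poly_Mapping.lookup m' (X i) + Poly_Mapping.lookup m' (Y i)"
    and cls: "\<And>c. (\<Sum>i | s i = c. Poly_Mapping.lookup m (X i)) = (\<Sum>i | s i = c. Poly_Mapping.lookup m' (X i))"
  shows "Poly_Mapping.single m 1 - Poly_Mapping.single m' 1 \<in> (graph_ideal W r :: ('v, 'k::field) lss_ring set)"
  using deg cls
proof (induction "\<Sum>i\<in>UNIV. Poly_Mapping.lookup m (X i) - Poly_Mapping.lookup m' (X i)"
    arbitrary: m rule: less_induct)
  case less
  let ?l = Poly_Mapping.lookup and ?s = "\<lambda>t. Poly_Mapping.single t (1 :: nat)"
  show ?case
  proof (cases "\<forall>i. ?l m (X i) \<le> ?l m' (X i)")
    case True
    have X: "?l m (X i) = ?l m' (X i)" for i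
    proof (rule ccontr)
      assume "?l m (X i) \<noteq> ?l m' (X i)"
      with True have "?l m (X i) < ?l m' (X i)"
        by (simp add: order_less_le)
      then have "(\<Sum>j | s j = s i. ?l m (X j)) < (\<Sum>j | s j = s i. ?l m' (X j))"
        using True by (intro sum_strict_mono_ex1) auto
      with less.prems(2) show False
        by simp
    qed
    then have "?l m (Y i) = ?l m' (Y i)" for i
      using less.prems(1)[of i] by simp
    with X have "m = m'"
      by (metis indet.exhaust poly_mapping_eqI)
    then show ?thesis
      by (simp add: ideal.span_zero)
  next
    case False
    then obtain i where i: "?l m' (X i) < ?l m (X i)"
      by (auto simp: not_le)
    have "\<exists>j. s j = s i \<and> ?l m (X j) < ?l m' (X j)"
    proof (rule ccontr)
      assume "\<not> ?thesis"
      then have "(\<Sum>j | s j = s i. ?l m' (X j)) < (\<Sum>j | s j = s i. ?l m (X j))"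
        using i by (intro sum_strict_mono_ex1) (auto simp: not_less)
      with less.prems(2) show False
        by simp
    qed
    then obtain j where j: "s j = s i" "?l m (X j) < ?l m' (X j)"
      by blast
    from i j have ij: "i \<noteq> j"
      by auto
    have jY: "0 < ?l m (Y j)"
      using less.prems(1)[of j] j(2) by simp
    \<comment> \<open>\<open>m0\<close> is the common cofactor of the move: \<open>m\<close>
      contains \<open>x_i y_j\<close>, and \<open>m1\<close> has \<open>x_j y_i\<close> in its
      place.\<close>
    define m0 where "m0 = m - (?s (X i) + ?s (Y j))"
    have m: "m = m0 + (?s (X i) + ?s (Y j))"
      unfolding m0_def using i jY
      by (intro poly_mapping_eqI) (auto simp: lookup_add lookup_minus lookup_single when_def)
    define m1 where "m1 = m0 + (?s (X j) + ?s (Y i))"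
    have lX: "?l m (X k) = ?l m0 (X k) + (if k = i then 1 else 0)"
      "?l m (Y k) = ?l m0 (Y k) + (if k = j then 1 else 0)"
      "?l m1 (X k) = ?l m0 (X k) + (if k = j then 1 else 0)"
      "?l m1 (Y k) = ?l m0 (Y k) + (if k = i then 1 else 0)" for k
      by (auto simp: m m1_def lookup_add lookup_single when_def)
    have "Poly_Mapping.single m1 1 - Poly_Mapping.single m' 1 \<in> (graph_ideal W r :: ('v, 'k) lss_ring set)"
    proof (rule less.hyps)
      \<comment> \<open>Subtraction is truncated, so only excess counts: it drops by one at
        \<open>i\<close>, and at \<open>j\<close> the strict inequality leaves room for the added
        factor.\<close>
      have "?l m1 (X k) - ?l m' (X k) \<le> ?l m (X k) - ?l m' (X k)" for k
        using ij j(2) by (auto simp: lX)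
      moreover have "?l m1 (X i) - ?l m' (X i) < ?l m (X i) - ?l m' (X i)"
        using ij i by (auto simp: lX)
      ultimately show "(\<Sum>k\<in>UNIV. ?l m1 (X k) - ?l m' (X k)) < (\<Sum>k\<in>UNIV. ?l m (X k) - ?l m' (X k))"
        by (intro sum_strict_mono_ex1) auto
      show "?l m1 (X k) + ?l m1 (Y k) = ?l m' (X k) + ?l m' (Y k)" for k
        using less.prems(1)[of k] by (simp add: lX)
      show "(\<Sum>k | s k = c. ?l m1 (X k)) = (\<Sum>k | s k = c. ?l m' (X k))" for c
        using less.prems(2)[of c] j(1) by (simp add: lX sum.distrib)
    qed
    moreover have "Poly_Mapping.single m0 1 * minor i j \<in> (graph_ideal W r :: ('v, 'k) lss_ring set)"
      using j(1) by (intro ideal.span_scale graph_ideal_minor s) simp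
    moreover have "Poly_Mapping.single m 1 - Poly_Mapping.single m' 1
      = Poly_Mapping.single m0 1 * minor i j + (Poly_Mapping.single m1 1 - Poly_Mapping.single m' (1::'k))"
      by (simp add: minor_def indet_def m m1_def mult_single right_diff_distrib)
    ultimately show ?thesis
      by (simp only: ideal.span_add)
  qed
qed

text \<open>
  In the target ring the variable \<open>(i, 0)\<close> is a scalar attached to the vertex \<open>i\<close>, and
  \<open>(c, 1)\<close>, \<open>(c, 2)\<close> are the coordinates of a vector attached to the class \<open>c\<close>:
  the vertex \<open>i\<close> is mapped to the product of its scalar with the vector of the class \<open>s i\<close>.
\<close>

fun point_exponent :: "('v \<Rightarrow> 'v) \<Rightarrow> 'v indet \<Rightarrow> ('v \<times> nat \<Rightarrow>\<^sub>0 nat)"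
  where "point_exponent s (X i) = Poly_Mapping.single (i, 0) 1 + Poly_Mapping.single (s i, 1) 1"
  | "point_exponent s (Y i) = Poly_Mapping.single (i, 0) 1 + Poly_Mapping.single (s i, 2) 1"

primrec indet_vertex :: "'v indet \<Rightarrow> 'v"
  where "indet_vertex (X i) = i" | "indet_vertex (Y i) = i"

definition point :: "'v set \<Rightarrow> ('v \<Rightarrow> 'v) \<Rightarrow> 'v indet \<Rightarrow> ('v \<times> nat \<Rightarrow>\<^sub>0 nat) \<Rightarrow>\<^sub>0 'k::field"
  where "point W s t = (if indet_vertex t \<in> W then 0 else Poly_Mapping.single (point_exponent s t) 1)"

text \<open>The exponent of the image of the monomial \<open>m\<close> when no vertex is killed:
  each variable contributes its point exponent, multiplied by its multiplicity in
  \<open>m\<close>.\<close>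

definition monom_exponent :: "('v::finite \<Rightarrow> 'v) \<Rightarrow> ('v indet \<Rightarrow>\<^sub>0 nat) \<Rightarrow> ('v \<times> nat \<Rightarrow>\<^sub>0 nat)"
  where "monom_exponent s m =
    (\<Sum>t\<in>UNIV. Poly_Mapping.map ((*) (Poly_Mapping.lookup m t)) (point_exponent s t))"

lemma lookup_map_mult: "Poly_Mapping.lookup (Poly_Mapping.map ((*) n) e) k = (n :: nat) * Poly_Mapping.lookup e k"
  by (simp add: Poly_Mapping.map.rep_eq when_def)

lemma single_power: "Poly_Mapping.single e (1 :: 'k::field) ^ n = Poly_Mapping.single (Poly_Mapping.map ((*) n) e) 1"
proof (induction n)
  case 0
  have "Poly_Mapping.map ((*) 0) e = 0"
    by (rule poly_mapping_eqI) (simp add: lookup_map_mult)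
  then show ?case by (simp only: power_0 single_one)
next
  case (Suc n)
  have "Poly_Mapping.map ((*) (Suc n)) e = e + Poly_Mapping.map ((*) n) e"
    by (rule poly_mapping_eqI) (simp add: lookup_map_mult lookup_add)
  with Suc show ?case
    by (simp only: power_Suc mult_single mult_1)
qed

lemma prod_single:
  "(\<Prod>t\<in>A. Poly_Mapping.single (e t) (1 :: 'k::field)) = Poly_Mapping.single (\<Sum>t\<in>A. e t) 1"
  by (induction A rule: infinite_finite_induct) (auto simp: mult_single)

text \<open>The image of a monomial thus determines the two invariants of
  \<open>single_diff_in_graph_ideal\<close>.\<close>

lemma lookup_monom_exponent:
  "Poly_Mapping.lookup (monom_exponent s m) (i, 0) = Poly_Mapping.lookup m (X i) + Poly_Mapping.lookup m (Y i)"
  "Poly_Mapping.lookup (monom_exponent s m) (c, Suc 0) = (\<Sum>i | s i = c. Poly_Mapping.lookup m (X i))"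
  by (simp_all add: monom_exponent_def lookup_sum lookup_map_mult sum_UNIV_indet lookup_add
      lookup_single mult_when) (simp_all add: when_def sum.If_cases)

lemma power_prod_point:
  assumes "\<And>t. indet_vertex t \<in> W \<Longrightarrow> Poly_Mapping.lookup m t = 0"
  shows "power_prod (point W s) m = Poly_Mapping.single (monom_exponent s m) (1 :: 'k::field)"
proof -
  have "power_prod (point W s) m
      = (\<Prod>t\<in>UNIV. Poly_Mapping.single (point_exponent s t) (1 :: 'k) ^ Poly_Mapping.lookup m t)"
    unfolding power_prod_def using assms by (intro prod.cong) (auto simp: point_def)
  then show ?thesis
    by (simp add: single_power prod_single monom_exponent_def)
qed

text \<open>
  A choice of one monomial in each nonempty fibre of the parametrization extends linearly to a map \<open>\<psi>\<close>
  such that \<open>\<psi> \<circ> subst (point W s)\<close> is the identity modulo the ideal.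
\<close>

lemma subst_point_eq_0_imp:
  fixes p :: "('v::{finite,linorder}, 'k::field) lss_ring"
  assumes s: "\<And>i j. s i = s j \<Longrightarrow> r i j" and p: "subst (point W s) p = 0"
  shows "p \<in> graph_ideal W r"
proof -
  let ?I = "graph_ideal W r :: ('v, 'k) lss_ring set"
  define avoids :: "('v indet \<Rightarrow>\<^sub>0 nat) \<Rightarrow> bool"
    where "avoids m \<longleftrightarrow> (\<forall>t. indet_vertex t \<in> W \<longrightarrow> Poly_Mapping.lookup m t = 0)" for m
  \<comment> \<open>The choice is meaningful for exponents in the image of the avoiding monomials;
    monomials that do not avoid \<open>W\<close> are mapped to zero.\<close>
  define rep where "rep n = (SOME m. avoids m \<and> monom_exponent s m = n)" for n
  define \<psi> :: "(('v \<times> nat \<Rightarrow>\<^sub>0 nat) \<Rightarrow>\<^sub>0 'k) \<Rightarrow> ('v, 'k) lss_ring"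
    where "\<psi> q = (\<Sum>n\<in>Poly_Mapping.keys q. Poly_Mapping.single (rep n) (Poly_Mapping.lookup q n))" for q
  have \<psi>_add: "\<psi> (q + q') = \<psi> q + \<psi> q'" for q q'
    unfolding \<psi>_def by (rule setsum_keys_plus_distrib) (simp_all add: single_add)
  have \<psi>_0: "\<psi> 0 = 0" and \<psi>_single: "\<psi> (Poly_Mapping.single n c) = Poly_Mapping.single (rep n) c" for n c
    by (simp_all add: \<psi>_def)
  have "p - \<psi> (subst (point W s) p) \<in> ?I"
  proof (induction p rule: poly_mapping_induct_single_add)
    case (1 m c)
    show ?case
    proof (cases "avoids m")
      case True
      then have "avoids (rep (monom_exponent s m)) \<and> monom_exponent s (rep (monom_exponent s m)) = monom_exponent s m"
        unfolding rep_def
        by (intro someI[of "\<lambda>m'. avoids m' \<and> monom_exponent s m' = monom_exponent s m" m]) simp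
      then have "monom_exponent s m = monom_exponent s (rep (monom_exponent s m))"
        by simp
      then have "Poly_Mapping.single m 1 - Poly_Mapping.single (rep (monom_exponent s m)) 1 \<in> ?I"
        by (intro single_diff_in_graph_ideal[of s] s) (metis lookup_monom_exponent)+
      then have "Poly_Mapping.single 0 c * (Poly_Mapping.single m 1 - Poly_Mapping.single (rep (monom_exponent s m)) 1) \<in> ?I"
        by (rule ideal.span_scale)
      moreover have "subst (point W s) (Poly_Mapping.single m c) = Poly_Mapping.single (monom_exponent s m) c"
        using True by (simp add: subst_single power_prod_point avoids_def mult_single)
      ultimately show ?thesis
        by (simp add: \<psi>_single mult_single right_diff_distrib)
    next
      case False
      \<comment> \<open>A monomial containing a variable of a killed vertex vanishes at the point
        and is a multiple of a generator.\<close>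
      then obtain t where t: "indet_vertex t \<in> W" "0 < Poly_Mapping.lookup m t"
        by (auto simp: avoids_def)
      then have "power_prod (point W s) m = (0 :: _ \<Rightarrow>\<^sub>0 'k)"
        unfolding power_prod_def by (intro prod_zero bexI[of _ t]) (auto simp: point_def)
      moreover have "indet t \<in> ?I"
        using t(1) by (cases t) (simp_all add: graph_ideal_x graph_ideal_y)
      then have "Poly_Mapping.single (m - Poly_Mapping.single t 1) c * indet t \<in> ?I"
        by (rule ideal.span_scale)
      moreover have "m = m - Poly_Mapping.single t 1 + Poly_Mapping.single t 1"
        using t(2) by (intro poly_mapping_eqI) (auto simp: lookup_add lookup_minus lookup_single when_def)
      then have "Poly_Mapping.single (m - Poly_Mapping.single t 1) c * indet t = Poly_Mapping.single m c"
        by (simp add: indet_def mult_single)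
      ultimately show ?thesis
        by (simp add: subst_single \<psi>_0)
    qed
  next
    case (2 p q)
    then have "(p - \<psi> (subst (point W s) p)) + (q - \<psi> (subst (point W s) q)) \<in> ?I"
      by (rule ideal.span_add)
    then show ?case
      by (simp add: subst_add \<psi>_add algebra_simps)
  qed
  with p show ?thesis
    by (simp add: \<psi>_0)
qed

text \<open>Vertices of one class receive proportional vectors and killed vertices receive zero, so
  all generators vanish.\<close>

lemma subst_point_graph_ideal:
  assumes s: "\<And>i j. r i j \<Longrightarrow> i \<notin> W \<Longrightarrow> j \<notin> W \<Longrightarrow> s i = s j" and p: "p \<in> graph_ideal W r"
  shows "subst (point W s) p = 0"
  using p
proof (induction rule: ideal.span_induct_alt)
  case (step c b p)
  from step.hyps have "subst (point W s) b = 0"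
  proof (cases rule: graph_generatorsE)
    case (3 i j)
    with s[of i j] show ?thesis
      by (simp add: minor_def subst_diff subst_mult point_def mult_single ac_simps)
  qed (simp_all add: point_def)
  with step.IH show ?case
    by (simp add: subst_add subst_mult)
qed simp

section \<open>Colon ideals\<close>

definition pairing :: "'v \<Rightarrow> 'v \<Rightarrow> ('v, 'k::field) lss_ring"
  where "pairing i j = x_var i * x_var j + y_var i * y_var j"

text \<open>The two products map to distinct monomials, told apart by the coordinate
  \<open>(s u, 1)\<close>. They cannot cancel, whatever the characteristic and even when
  \<open>u\<close> and \<open>v\<close> share a class.\<close>

lemma subst_point_pairing:
  assumes "u \<notin> W" "v \<notin> W"
  shows "subst (point W s) (pairing u v) \<noteq> (0 :: _ \<Rightarrow>\<^sub>0 'k::field)"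
proof
  let ?e = "point_exponent s (X u) + point_exponent s (X v)"
  assume "subst (point W s) (pairing u v) = (0 :: _ \<Rightarrow>\<^sub>0 'k::field)"
  then have "Poly_Mapping.lookup (subst (point W s) (pairing u v) :: _ \<Rightarrow>\<^sub>0 'k) ?e = 0"
    by simp
  moreover have "Poly_Mapping.lookup ?e (s u, 1)
      \<noteq> Poly_Mapping.lookup (point_exponent s (Y u) + point_exponent s (Y v)) (s u, 1)"
    by (simp add: lookup_add lookup_single)
  then have "point_exponent s (Y u) + point_exponent s (Y v) \<noteq> ?e"
    by metis
  ultimately show False
    using assms
    by (simp add: pairing_def subst_add subst_mult point_def mult_single lookup_add lookup_single
        del: point_exponent.simps)
qed

text \<open>For different classes the coordinate \<open>(s u, 1)\<close> occurs in the image of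
  \<open>x_u y_v\<close> but not in that of \<open>x_v y_u\<close>.\<close>

lemma subst_point_minor:
  assumes "u \<notin> W" "v \<notin> W" "s u \<noteq> s v"
  shows "subst (point W s) (minor u v) \<noteq> (0 :: _ \<Rightarrow>\<^sub>0 'k::field)"
proof
  let ?e = "point_exponent s (X u) + point_exponent s (Y v)"
  assume "subst (point W s) (minor u v) = (0 :: _ \<Rightarrow>\<^sub>0 'k::field)"
  then have "Poly_Mapping.lookup (subst (point W s) (minor u v) :: _ \<Rightarrow>\<^sub>0 'k) ?e = 0"
    by simp
  moreover have "Poly_Mapping.lookup ?e (s u, 1)
      \<noteq> Poly_Mapping.lookup (point_exponent s (X v) + point_exponent s (Y u)) (s u, 1)"
    using assms(3) by (simp add: lookup_add lookup_single)
  then have "point_exponent s (X v) + point_exponent s (Y u) \<noteq> ?e"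
    by metis
  ultimately show False
    using assms
    by (simp add: minor_def subst_diff subst_mult point_def mult_single lookup_minus lookup_single
        del: point_exponent.simps)
qed

text \<open>The two kinds of non-zero-divisors treated in parallel. The second is stated with
  connectivity because completion adds edges but preserves the components.\<close>

definition separates :: "('v, 'k::field) lss_ring \<Rightarrow> ('v \<Rightarrow> 'v \<Rightarrow> bool) \<Rightarrow> 'v \<Rightarrow> 'v \<Rightarrow> bool"
  where "separates q r u v \<longleftrightarrow> q = pairing u v \<or> (q = minor u v \<and> \<not> r\<^sup>*\<^sup>* u v)"

text \<open>When all remaining vertices are closed, \<open>r\<close> is an equivalence outside
  \<open>W\<close>, so the ideal is the kernel of a homomorphism to a domain; the image of
  \<open>q\<close> is nonzero there.\<close>

lemma graph_ideal_cancel_equiv: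
  fixes c :: "('v::{finite,linorder}, 'k::field) lss_ring"
  assumes r: "reflp r" "symp r" "\<And>w. w \<notin> W \<Longrightarrow> closed_at r w"
    and uv: "u \<notin> W" "v \<notin> W" "separates q r u v"
    and c: "c * q \<in> graph_ideal W r"
  shows "c \<in> graph_ideal W r"
proof -
  \<comment> \<open>Killed vertices become singleton classes, which makes \<open>r'\<close> an
    equivalence on all vertices; \<open>s\<close> then picks a representative of each class.\<close>
  define r' where "r' i j \<longleftrightarrow> i = j \<or> (r i j \<and> i \<notin> W \<and> j \<notin> W)" for i j
  have trans: "r' i k" if "r' i j" "r' j k" for i j k
    using that r unfolding r'_def closed_at_def symp_def by metis
  have sym: "r' j i" if "r' i j" for i j
    using that r(2) by (auto simp: r'_def symp_def)
  define s where "s i = (SOME j. r' i j)" for i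
  have s: "r' i (s i)" for i
    unfolding s_def by (rule someI[of _ i]) (simp add: r'_def)
  have eq: "s i = s j \<longleftrightarrow> r' i j" for i j
  proof
    show "s i = s j \<Longrightarrow> r' i j"
      by (metis s sym trans)
    assume "r' i j"
    then have "r' i = r' j"
      using sym trans by (intro ext) blast
    then show "s i = s j"
      by (simp add: s_def)
  qed
  let ?\<phi> = "subst (point W s) :: ('v, 'k) lss_ring \<Rightarrow> (_ \<Rightarrow>\<^sub>0 'k)"
  have "?\<phi> (c * q) = 0"
    using c by (rule subst_point_graph_ideal[rotated]) (simp add: eq r'_def)
  moreover have "?\<phi> q \<noteq> 0"
  proof -
    consider "q = pairing u v" | "q = minor u v" "\<not> r\<^sup>*\<^sup>* u v"
      using uv(3) by (auto simp: separates_def)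
    then show ?thesis
    proof cases
      case 2
      then have "s u \<noteq> s v"
        by (auto simp: eq r'_def)
      with 2 uv show ?thesis
        by (simp add: subst_point_minor)
    qed (use uv in \<open>simp add: subst_point_pairing\<close>)
  qed
  ultimately have "?\<phi> c = 0"
    by (simp add: subst_mult)
  then show ?thesis
    by (rule subst_point_eq_0_imp[rotated]) (use r(1) in \<open>auto simp: eq r'_def reflp_def\<close>)
qed

text \<open>Induction on the number of remaining vertices that are not closed. Both ideals of
  \<open>graph_ideal_decompose\<close> have fewer of them, and both contain \<open>c * q\<close>.
  Since \<open>u\<close> and \<open>v\<close> are closed, they are never the vertex \<open>w\<close>
  that is killed.\<close>

lemma graph_ideal_cancel:
  fixes c :: "('v::{finite,linorder}, 'k::field) lss_ring"
  assumes r: "reflp r" "symp r" "closed_at r u" "closed_at r v"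
    and uv: "u \<notin> W" "v \<notin> W" "separates q r u v"
    and c: "c * q \<in> graph_ideal W r"
  shows "c \<in> graph_ideal W r"
  using assms
proof (induction "card {w. w \<notin> W \<and> \<not> closed_at r w}" arbitrary: r W rule: less_induct)
  case less
  show ?case
  proof (cases "\<forall>w. w \<notin> W \<longrightarrow> closed_at r w")
    case True
    with less.prems show ?thesis
      using graph_ideal_cancel_equiv[of r W u v q c] by blast
  next
    case False
    then obtain w where w: "w \<notin> W" "\<not> closed_at r w"
      by blast
    let ?N = "\<lambda>W r. {w. w \<notin> W \<and> \<not> closed_at r w}"
    have "?N W (complete_at r w) \<subset> ?N W r"
      using w less.prems closed_at_complete_at[of r w] closed_at_complete_at_other[of r _ w] by blast
    moreover have "?N (insert w W) r \<subset> ?N W r"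
      using w by blast
    ultimately have lt: "card (?N W (complete_at r w)) < card (?N W r)" "card (?N (insert w W) r) < card (?N W r)"
      by (simp_all add: psubset_card_mono)
    have c1: "c * q \<in> graph_ideal W (complete_at r w)"
      using less.prems(8) by (rule subsetD[OF ideal.span_mono, rotated])
        (auto simp: graph_generators_def complete_at_def)
    have "separates q (complete_at r w) u v"
      using less.prems by (simp add: separates_def rtranclp_complete_at)
    from less.hyps[OF lt(1) _ _ _ _ _ _ this c1]
    have *: "c \<in> graph_ideal W (complete_at r w)"
      using less.prems by (simp add: reflp_complete_at symp_complete_at closed_at_complete_at_other)
    have c2: "c * q \<in> graph_ideal (insert w W) r"
      using less.prems(8) by (rule subsetD[OF ideal.span_mono, rotated])
        (auto simp: graph_generators_def)
    have "u \<noteq> w" "v \<noteq> w"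
      using w less.prems by auto
    with less.hyps[OF lt(2) _ _ _ _ _ _ _ c2]
    have "c \<in> graph_ideal (insert w W) r"
      using less.prems by simp
    with * show ?thesis
      by (rule graph_ideal_decompose[OF less.prems(1,2)])
  qed
qed

text \<open>Enlarging the ideal by completion at \<open>u\<close> and \<open>v\<close> makes both
  vertices closed, so that \<open>q\<close> can be cancelled in the enlarged ideal.\<close>

lemma graph_ideal_colon:
  fixes c :: "('v::{finite,linorder}, 'k::field) lss_ring"
  assumes r: "reflp r" "symp r" and uv: "\<not> r u v" "separates q r u v"
    and c: "c * q \<in> graph_ideal {} r"
  shows "c \<in> graph_ideal {} (\<lambda>i j. r i j \<or> (r u i \<and> r u j) \<or> (r v i \<and> r v j))"
proof -
  let ?r = "complete_at (complete_at r u) v"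
  \<comment> \<open>As \<open>u\<close> and \<open>v\<close> are not adjacent, completion at
    \<open>u\<close> does not change the neighbourhood of \<open>v\<close>.\<close>
  have "?r = (\<lambda>i j. r i j \<or> (r u i \<and> r u j) \<or> (r v i \<and> r v j))"
    using r uv(1) by (auto simp: complete_at_def fun_eq_iff symp_def)
  moreover have "c \<in> graph_ideal {} ?r"
  proof (rule graph_ideal_cancel)
    show "separates q ?r u v"
      using uv(2) r by (simp add: separates_def rtranclp_complete_at symp_complete_at)
    show "c * q \<in> graph_ideal {} ?r"
      using c by (rule subsetD[OF ideal.span_mono, rotated])
        (auto simp: graph_generators_def complete_at_def)
  qed (use r in \<open>auto intro: reflp_complete_at symp_complete_at closed_at_complete_at closed_at_complete_at_other\<close>)
  ultimately show ?thesis
    by simp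
qed

section \<open>From minors to the forms g by rotating one colour class\<close>

lemma g_poly_pairing: "g_poly {i, j} = pairing i j"
  by (simp add: g_pair pairing_def)

lemma minor_commute: "minor j i = - minor i j"
  by (simp add: minor_def)

lemma f_poly_minor: "f_poly {i, j} = (if i \<le> j then minor i j else - minor i j)"
proof (cases "i \<le> j")
  case False
  then have "f_poly {j, i} = (minor j i :: ('a, 'b) lss_ring)"
    by (simp add: f_pair minor_def)
  with False show ?thesis
    by (simp add: insert_commute minor_commute[of i])
qed (simp add: f_pair minor_def)

lemma simple_graph_edgeE:
  assumes "simple_graph E" "d \<in> E"
  obtains i j where "d = {i, j}" "i \<noteq> j"
  using assms by (metis card_2_iff simple_graph_def)

lemma simple_graph_neq: "simple_graph E \<Longrightarrow> {i, j} \<in> E \<Longrightarrow> i \<noteq> j"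
  by (auto simp: simple_graph_def)

abbreviation adjacent :: "'v set set \<Rightarrow> 'v \<Rightarrow> 'v \<Rightarrow> bool"
  where "adjacent F \<equiv> (\<lambda>i j. {i, j} \<in> F)"

text \<open>
  Rotating the vectors \<open>(x i, y i)\<close> by a right angle at the vertices of one colour class
  turns the forms \<open>g\<close> of a properly coloured graph into minors, up to sign.
\<close>

definition rotation :: "('v \<Rightarrow> bool) \<Rightarrow> 'v indet \<Rightarrow> ('v, 'k::field) lss_ring"
  where "rotation \<sigma> t = (case t of X i \<Rightarrow> if \<sigma> i then x_var i else y_var i
    | Y i \<Rightarrow> if \<sigma> i then y_var i else - x_var i)"

definition rotation_inv :: "('v \<Rightarrow> bool) \<Rightarrow> 'v indet \<Rightarrow> ('v, 'k::field) lss_ring"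
  where "rotation_inv \<sigma> t = (case t of X i \<Rightarrow> if \<sigma> i then x_var i else - y_var i
    | Y i \<Rightarrow> if \<sigma> i then y_var i else x_var i)"

lemma subst_rotation_rotation_inv: "subst (rotation \<sigma>) (subst (rotation_inv \<sigma>) p) = p"
  by (rule subst_inverse) (simp add: rotation_def rotation_inv_def subst_uminus split: indet.split)

lemma subst_rotation_minor:
  "subst (rotation \<sigma>) (minor i j) =
    (if \<sigma> i = \<sigma> j then minor i j else if \<sigma> i then - pairing i j else pairing i j)"
  by (simp add: minor_def pairing_def subst_diff subst_mult rotation_def algebra_simps)

lemma subst_rotation_inv_pairing:
  "subst (rotation_inv \<sigma>) (pairing i j) =
    (if \<sigma> i = \<sigma> j then pairing i j else if \<sigma> i then - minor i j else minor i j)"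
  by (simp add: minor_def pairing_def subst_add subst_mult rotation_inv_def algebra_simps)

text \<open>The inverse rotation carries the question to \<open>graph_ideal_colon\<close>. Rotating
  back, minors of edges become forms g up to sign, whereas the minors of two neighbours of
  \<open>u\<close> or of \<open>v\<close> are fixed, such neighbours having equal colours.\<close>

lemma lss_ideal_colon:
  fixes c :: "('v::{finite,linorder}, 'k::field) lss_ring"
    and \<sigma> :: "'v \<Rightarrow> bool"
  assumes F: "simple_graph F" and \<sigma>: "\<And>i j. {i, j} \<in> F \<Longrightarrow> \<sigma> i \<noteq> \<sigma> j"
    and uv: "u \<noteq> v" "{u, v} \<notin> F" "\<sigma> u = \<sigma> v \<or> \<not> (adjacent F)\<^sup>*\<^sup>* u v"
    and c: "c * g_poly {u, v} \<in> ideal.span (g_poly ` F)"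
  shows "c \<in> ideal.span (g_poly ` F \<union> {minor i j | i j. {u, i} \<in> F \<and> {u, j} \<in> F}
    \<union> {minor i j | i j. {v, i} \<in> F \<and> {v, j} \<in> F})" (is "c \<in> ideal.span ?B")
proof -
  define r where "r i j \<longleftrightarrow> i = j \<or> {i, j} \<in> F" for i j
  let ?\<theta> = "subst (rotation \<sigma>) :: ('v, 'k) lss_ring \<Rightarrow> ('v, 'k) lss_ring"
  let ?\<theta>' = "subst (rotation_inv \<sigma>) :: ('v, 'k) lss_ring \<Rightarrow> ('v, 'k) lss_ring"
  have r: "reflp r" "symp r"
    by (auto simp: r_def reflp_def symp_def insert_commute)
  have "r\<^sup>*\<^sup>* \<le> ((adjacent F)\<^sup>*\<^sup>*)\<^sup>*\<^sup>*"
    by (rule rtranclp_mono) (auto simp: r_def)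
  then have conn: "\<not> r\<^sup>*\<^sup>* u v" if "\<not> (adjacent F)\<^sup>*\<^sup>* u v"
    using that by auto
  have not_r: "\<not> r u v"
    using uv by (simp add: r_def)
  have "?\<theta>' (c * g_poly {u, v}) \<in> graph_ideal {} r"
    using c
  proof (rule subst_span)
    fix b :: "('v, 'k) lss_ring" assume "b \<in> g_poly ` F"
    then obtain i j where b: "b = g_poly {i, j}" "{i, j} \<in> F"
      by (metis F imageE simple_graph_edgeE)
    then have "minor i j \<in> (graph_ideal {} r :: ('v, 'k) lss_ring set)"
      by (intro graph_ideal_minor) (simp add: r_def)
    then show "?\<theta>' b \<in> graph_ideal {} r"
      using \<sigma>[OF b(2)] by (simp add: b g_poly_pairing subst_rotation_inv_pairing ideal.span_neg)
  qed
  then have c': "?\<theta>' c * ?\<theta>' (pairing u v) \<in> graph_ideal {} r"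
    by (simp add: subst_mult g_poly_pairing)
  \<comment> \<open>For equal colours the form g stays a pairing; for different ones it becomes a
    minor up to sign, and then \<open>u\<close> and \<open>v\<close> lie in different
    components.\<close>
  have "\<exists>q. separates q r u v \<and> ?\<theta>' c * q \<in> graph_ideal {} r"
  proof (cases "\<sigma> u = \<sigma> v")
    case True
    with c' show ?thesis
      by (auto simp: separates_def subst_rotation_inv_pairing)
  next
    case False
    with c' have "?\<theta>' c * minor u v \<in> graph_ideal {} r \<or> - (?\<theta>' c * minor u v) \<in> graph_ideal {} r"
      by (auto simp: subst_rotation_inv_pairing split: if_splits)
    then have "?\<theta>' c * minor u v \<in> graph_ideal {} r"
      using ideal.span_neg by fastforce
    with False show ?thesis
      using uv(3) conn by (auto simp: separates_def)
  qed
  then obtain q where "separates q r u v" "?\<theta>' c * q \<in> graph_ideal {} r"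
    by blast
  then have "?\<theta>' c \<in> graph_ideal {} (\<lambda>i j. r i j \<or> (r u i \<and> r u j) \<or> (r v i \<and> r v j))"
    by (rule graph_ideal_colon[OF r not_r])
  then have "?\<theta> (?\<theta>' c) \<in> ideal.span ?B"
  proof (rule subst_span)
    have edge: "?\<theta> (minor i j) \<in> ideal.span ?B" if "r i j" for i j
    proof (cases "i = j")
      case False
      with that have ij: "{i, j} \<in> F"
        by (simp add: r_def)
      then have "g_poly {i, j} \<in> ideal.span ?B"
        by (intro ideal.span_base) simp
      then show ?thesis
        using \<sigma>[OF ij] by (simp add: g_poly_pairing subst_rotation_minor ideal.span_neg)
    qed (simp add: ideal.span_zero)
    \<comment> \<open>Because \<open>r\<close> is reflexive, \<open>w\<close> counts as its own
      neighbour; the pairs containing \<open>w\<close> are edges or trivial.\<close>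
    have nbrs: "?\<theta> (minor i j) \<in> ideal.span ?B" if "r w i" "r w j" "w = u \<or> w = v" for w i j
    proof (cases "w = i \<or> w = j")
      case True
      with that r(2) have "r i j"
        unfolding symp_def by blast
      then show ?thesis
        by (rule edge)
    next
      case False
      with that have ij: "{w, i} \<in> F" "{w, j} \<in> F"
        by (simp_all add: r_def)
      then have "minor i j \<in> ideal.span ?B"
        using that(3) by (intro ideal.span_base) blast
      then show ?thesis
        using \<sigma>[OF ij(1)] \<sigma>[OF ij(2)] by (simp add: subst_rotation_minor)
    qed
    fix b :: "('v, 'k) lss_ring"
    assume "b \<in> graph_generators {} (\<lambda>i j. r i j \<or> (r u i \<and> r u j) \<or> (r v i \<and> r v j))"
    then show "?\<theta> b \<in> ideal.span ?B"
      by (cases rule: graph_generatorsE) (use edge nbrs in blast)+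
  qed
  then show ?thesis
    by (simp add: subst_rotation_rotation_inv)
qed

section \<open>Generation of the syzygy module\<close>

abbreviation syzygy_generators ::
    "('v::{finite,linorder} set \<times> 'v set) set \<Rightarrow> 'v set set \<Rightarrow> ('v set \<Rightarrow> ('v, 'k::field) lss_ring) set"
  where "syzygy_generators R F \<equiv> koszul_syzygies R F \<union> claw_syzygies F"

section \<open>The listed elements are syzygies and lift generators of the colon ideal\<close>

lemma scale_apply: "scale a c d = a * c d"
  by (simp add: scale_def)

lemma koszul_apply:
  "koszul d d' e = (if e = d' then g_poly d else 0) - (if e = d then g_poly d' else 0)"
  by (simp add: koszul_def edge_basis_def scale_apply)

lemma claw_combination_apply:
  "claw_combination A u v w z e =
      (if e = {u, v} then (- 1) ^ position A v * f_poly {z, w} else 0)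
    + (if e = {u, z} then (- 1) ^ position A z * f_poly {v, w} else 0)
    + (if e = {u, w} then (- 1) ^ position A w * f_poly {v, z} else 0)"
  by (simp add: claw_combination_def edge_basis_def scale_apply)

text \<open>The three terms are indexed by the leaves, each symmetric in the other two leaves, and
  the positions depend only on the leaf set. So sorting the leaves reduces all orders to
  \<open>claw_identity\<close>.\<close>

lemma claw_relation:
  fixes u v w z :: "'v::{finite,linorder}"
  assumes "v \<noteq> w" "v \<noteq> z" "w \<noteq> z" "u \<notin> {v, w, z}"
  defines "A \<equiv> {u, v, w, z} - {u}"
  shows "(- 1) ^ position A v * f_poly {z, w} * g_poly {u, v}
    + (- 1) ^ position A z * f_poly {v, w} * g_poly {u, z}
    + (- 1) ^ position A w * f_poly {v, z} * g_poly {u, w}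
    = (0 :: ('v, 'k::field) lss_ring)"
proof -
  define t :: "'v \<Rightarrow> 'v \<Rightarrow> 'v \<Rightarrow> ('v, 'k) lss_ring"
    where "t a b c = (- 1) ^ position A a * f_poly {b, c} * g_poly {u, a}" for a b c
  have t: "t a b c = t a c b" for a b c
    by (simp add: t_def insert_commute)
  have sorted: "t a b c + t b a c + t c a b = 0" if "a < b" "b < c" "{a, b, c} = {v, w, z}" for a b c
  proof -
    have "{u, a, b, c} - {u} = A"
      using that(3) by (simp add: A_def)
    then show ?thesis
      using claw_identity[of a b c u, where 'k = 'k] that assms(4)
      by (simp add: t_def ac_simps insert_commute)
  qed
  consider "v < w" "w < z" | "v < z" "z < w" | "w < v" "v < z" | "w < z" "z < v" | "z < v" "v < w"
    | "z < w" "w < v"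
    using assms(1-3) by (metis linorder_neqE)
  then have "t v w z + t w v z + t z v w = 0"
  proof cases
    case 1 then show ?thesis using sorted[of v w z] by simp
  next
    case 2 then show ?thesis using sorted[of v z w] by (simp add: insert_commute t[of v z] ac_simps)
  next
    case 3 then show ?thesis using sorted[of w v z] by (simp add: insert_commute t[of z w] ac_simps)
  next
    case 4 then show ?thesis using sorted[of w z v]
      by (simp add: insert_commute t[of w z] t[of z w] ac_simps)
  next
    case 5 then show ?thesis using sorted[of z v w]
      by (simp add: insert_commute t[of v z] t[of w z] ac_simps)
  next
    case 6 then show ?thesis using sorted[of z w v]
      by (simp add: insert_commute t[of v z] t[of w z] t[of z w] ac_simps)
  qed
  then show ?thesis
    by (simp add: t_def ac_simps insert_commute)
qed

lemma subspace_first_syzygy: "edge_module.subspace (first_syzygy E)"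
  by (rule edge_module.subspaceI)
    (auto simp: first_syzygy_def scale_apply distrib_right sum.distrib mult.assoc simp flip: sum_distrib_left)

lemma koszul_in_first_syzygy:
  assumes "d \<in> E" "d' \<in> E"
  shows "koszul d d' \<in> first_syzygy E"
proof -
  have "(\<Sum>e\<in>E. koszul d d' e * g_poly e)
      = (\<Sum>e\<in>E. if e = d' then g_poly d * g_poly d' else 0) - (\<Sum>e\<in>E. if e = d then g_poly d' * g_poly d else 0)"
    unfolding sum_subtractf[symmetric] by (intro sum.cong) (auto simp: koszul_apply left_diff_distrib)
  with assms show ?thesis
    by (auto simp: first_syzygy_def koszul_apply mult.commute)
qed

lemma claw_in_first_syzygy:
  assumes E: "simple_graph E" and claw: "is_claw E u v w z"
  shows "claw_combination ({u, v, w, z} - {u}) u v w z \<in> first_syzygy E"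
proof -
  let ?p = "\<lambda>i. (- 1) ^ position ({u, v, w, z} - {u}) i"
  have edges: "{u, v} \<in> E" "{u, w} \<in> E" "{u, z} \<in> E" and ne: "v \<noteq> w" "v \<noteq> z" "w \<noteq> z"
    using claw by (auto simp: is_claw_def)
  have u: "u \<notin> {v, w, z}"
    using edges E by (auto simp: simple_graph_def)
  have "(\<Sum>e\<in>E. claw_combination ({u, v, w, z} - {u}) u v w z e * g_poly e)
      = (\<Sum>e\<in>E. if e = {u, v} then ?p v * f_poly {z, w} * g_poly {u, v} else 0)
      + (\<Sum>e\<in>E. if e = {u, z} then ?p z * f_poly {v, w} * g_poly {u, z} else 0)
      + (\<Sum>e\<in>E. if e = {u, w} then ?p w * f_poly {v, z} * g_poly {u, w} else 0)"
    unfolding sum.distrib[symmetric]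
    by (intro sum.cong) (auto simp: claw_combination_apply distrib_right)
  also have "\<dots> = 0"
    using edges claw_relation[OF ne u] by simp
  finally show ?thesis
    using edges by (auto simp: first_syzygy_def claw_combination_apply)
qed

lemma span_syzygy_generators_subset:
  assumes "simple_graph E"
  shows "edge_module.span (syzygy_generators R E) \<subseteq> first_syzygy E"
  by (rule edge_module.span_minimal[OF _ subspace_first_syzygy])
    (use koszul_in_first_syzygy claw_in_first_syzygy[OF assms] in
      \<open>auto simp: koszul_syzygies_def claw_syzygies_def simp del: insert_Diff_single insert_Diff1 Diff_insert0\<close>)

lemma koszul_in_span:
  assumes "selects_orders R E" "d \<in> E" "d' \<in> E" "d \<noteq> d'"
  shows "koszul d d' \<in> edge_module.span (syzygy_generators R E)"
proof (cases "(d, d') \<in> R")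
  case True
  with assms show ?thesis
    by (intro edge_module.span_base) (auto simp: koszul_syzygies_def)
next
  case False
  with assms have "(d', d) \<in> R"
    unfolding selects_orders_def by blast
  with assms have "koszul d' d \<in> edge_module.span (syzygy_generators R E)"
    by (intro edge_module.span_base) (auto simp: koszul_syzygies_def)
  then have "- koszul d' d \<in> edge_module.span (syzygy_generators R E)"
    by (rule edge_module.span_neg)
  then show ?thesis
    by (simp add: koszul_def)
qed

text \<open>The claw with center \<open>u\<close> and leaves \<open>v\<close>, \<open>i\<close>,
  \<open>j\<close> has the minor of \<open>i\<close> and \<open>j\<close>, up to sign, as its
  coefficient at \<open>{u, v}\<close>.\<close>

lemma minor_lifts:
  assumes E: "simple_graph E" and edges: "{u, v} \<in> E" "{u, i} \<in> E" "{u, j} \<in> E" "i \<noteq> v" "j \<noteq> v"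
  shows "\<exists>b\<in>edge_module.span (syzygy_generators R E). b {u, v} = minor i j"
proof (cases "i = j")
  case True
  then show ?thesis
    by (intro bexI[of _ 0]) (auto intro: edge_module.span_zero)
next
  case False
  let ?A = "{u, v, i, j} - {u}"
  \<comment> \<open>The first factor cancels the sign in the claw; the second accounts for f reading
    its pair in increasing order.\<close>
  let ?s = "(- 1) ^ position ?A v * (if i \<le> j then 1 else - 1)"
  let ?c = "claw_combination ?A u v i j"
  have "is_claw E u v i j"
    using edges False by (auto simp: is_claw_def)
  then have "?c \<in> edge_module.span (syzygy_generators R E)"
    by (intro edge_module.span_base) (auto simp: claw_syzygies_def)
  then have "scale ?s ?c \<in> edge_module.span (syzygy_generators R E)"
    by (rule edge_module.span_scale)
  moreover have "{u, v} \<noteq> {u, i}" "{u, v} \<noteq> {u, j}"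
    using edges by (auto simp: doubleton_eq_iff)
  moreover have "(- 1) ^ position ?A v * ((- 1) ^ position ?A v * p) = p" for p :: "('a, 'b) lss_ring"
    by (metis (no_types, lifting) left_minus_one_mult_self mult.assoc)
  ultimately show ?thesis
    by (intro bexI[of _ "scale ?s ?c"])
      (simp_all add: scale_apply claw_combination_apply insert_commute[of j] f_poly_minor ac_simps)
qed

text \<open>Taking the coefficient at \<open>d\<close> is linear over the ring, so lifting the
  generators of an ideal lifts the ideal.\<close>

lemma lift_span:
  assumes "a \<in> ideal.span G" and "\<And>g. g \<in> G \<Longrightarrow> \<exists>b\<in>edge_module.span B. b d = g"
  shows "\<exists>b\<in>edge_module.span B. b d = a"
  using assms(1)
proof (induction rule: ideal.span_induct_alt)
  case base
  show ?case
    by (intro bexI[of _ 0]) (auto intro: edge_module.span_zero)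
next
  case (step p g a)
  obtain b b' where "b \<in> edge_module.span B" "b d = g" "b' \<in> edge_module.span B" "b' d = a"
    using step.IH assms(2)[OF step.hyps] by blast
  then show ?case
    by (intro bexI[of _ "scale p b + b'"] edge_module.span_add edge_module.span_scale)
      (simp_all add: scale_apply)
qed

text \<open>The coefficient of a syzygy \<open>c\<close> at the new edge lies in the colon ideal,
  hence is also the coefficient of some \<open>b\<close> in the span. The difference
  \<open>c - b\<close> vanishes at the new edge, so it is a syzygy of \<open>F\<close>.\<close>

lemma syzygies_generated_insert:
  fixes F :: "'v::{finite,linorder} set set" and \<sigma> :: "'v \<Rightarrow> bool"
  assumes F: "simple_graph (insert {u, v} F)" "selects_orders R (insert {u, v} F)"
    and \<sigma>: "\<And>i j. {i, j} \<in> F \<Longrightarrow> \<sigma> i \<noteq> \<sigma> j"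
    and uv: "u \<noteq> v" "{u, v} \<notin> F" "\<sigma> u = \<sigma> v \<or> \<not> (adjacent F)\<^sup>*\<^sup>* u v"
    and IH: "first_syzygy F \<subseteq> (edge_module.span (syzygy_generators R F) :: ('v set \<Rightarrow> ('v, 'k::field) lss_ring) set)"
  shows "first_syzygy (insert {u, v} F)
    \<subseteq> (edge_module.span (syzygy_generators R (insert {u, v} F)) :: ('v set \<Rightarrow> ('v, 'k) lss_ring) set)"
proof
  let ?F = "insert {u, v} F"
  let ?N = "edge_module.span (syzygy_generators R ?F) :: ('v set \<Rightarrow> ('v, 'k) lss_ring) set"
  fix c :: "'v set \<Rightarrow> ('v, 'k) lss_ring" assume c: "c \<in> first_syzygy ?F"
  have "c {u, v} * g_poly {u, v} = - (\<Sum>d\<in>F. c d * g_poly d)"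
    using c uv(2) by (simp add: first_syzygy_def eq_neg_iff_add_eq_0)
  also have "\<dots> \<in> ideal.span (g_poly ` F)"
    by (intro ideal.span_neg ideal.span_sum ideal.span_scale ideal.span_base) simp
  finally have "c {u, v} * g_poly {u, v} \<in> ideal.span (g_poly ` F)" .
  moreover have "simple_graph F"
    using F(1) by (simp add: simple_graph_def)
  ultimately have "c {u, v} \<in> ideal.span (g_poly ` F \<union> {minor i j | i j. {u, i} \<in> F \<and> {u, j} \<in> F}
      \<union> {minor i j | i j. {v, i} \<in> F \<and> {v, j} \<in> F})"
    using lss_ideal_colon[of F \<sigma> u v] \<sigma> uv by blast
  then have "\<exists>b\<in>?N. b {u, v} = c {u, v}"
  proof (rule lift_span)
    fix g :: "('v, 'k) lss_ring"
    assume "g \<in> g_poly ` F \<union> {minor i j | i j. {u, i} \<in> F \<and> {u, j} \<in> F}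
      \<union> {minor i j | i j. {v, i} \<in> F \<and> {v, j} \<in> F}"
    then consider d where "d \<in> F" "g = g_poly d"
      | i j where "{u, i} \<in> F" "{u, j} \<in> F" "g = minor i j"
      | i j where "{v, i} \<in> F" "{v, j} \<in> F" "g = minor i j"
      by blast
    then show "\<exists>b\<in>?N. b {u, v} = g"
    proof cases
      case 1
      then have "d \<noteq> {u, v}"
        using uv(2) by blast
      with 1 show ?thesis
        using koszul_in_span[OF F(2), of d "{u, v}"]
        by (intro bexI[of _ "koszul d {u, v}"]) (simp_all add: koszul_apply)
    next
      case 2
      with uv(2) show ?thesis
        using minor_lifts[OF F(1), of u v i j] by auto
    next
      case 3
      with uv(2) show ?thesis
        using minor_lifts[OF F(1), of v u i j] by (auto simp: insert_commute)
    qed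
  qed
  then obtain b where b: "b \<in> ?N" "b {u, v} = c {u, v}"
    by blast
  then have "b \<in> first_syzygy ?F"
    using span_syzygy_generators_subset[OF F(1)] by blast
  then have "c - b \<in> first_syzygy ?F"
    using c by (simp add: edge_module.subspace_diff subspace_first_syzygy)
  moreover have "(c - b) {u, v} = 0"
    using b(2) by simp
  ultimately have "c - b \<in> first_syzygy F"
    using uv(2) unfolding first_syzygy_def by (simp del: minus_apply fun_diff_def) metis
  then have "c - b \<in> edge_module.span (syzygy_generators R F)"
    using IH by blast
  moreover have "syzygy_generators R F \<subseteq> (syzygy_generators R ?F :: ('v set \<Rightarrow> ('v, 'k) lss_ring) set)"
    unfolding koszul_syzygies_def claw_syzygies_def is_claw_def by blast
  ultimately have "c - b \<in> ?N"
    using edge_module.span_mono by blast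
  then have "(c - b) + b \<in> ?N"
    using b(1) by (rule edge_module.span_add)
  then show "c \<in> ?N"
    by simp
qed

section \<open>Forests and odd unicyclic graphs\<close>

lemma is_cycle_mono: "is_cycle F C \<Longrightarrow> F \<subseteq> E \<Longrightarrow> is_cycle E C"
  by (auto simp: is_cycle_def)

text \<open>Loop erasure: when a step returns to a vertex of the path, the path is cut off at that
  vertex.\<close>

lemma connected_imp_distinct_path:
  assumes "(adjacent F)\<^sup>*\<^sup>* a b"
  shows "\<exists>xs. xs \<noteq> [] \<and> hd xs = a \<and> last xs = b \<and> distinct xs \<and> successively (adjacent F) xs"
  using assms
proof (induction rule: rtranclp_induct)
  case base
  show ?case
    by (intro exI[of _ "[a]"]) simp
next
  case (step y z)
  then obtain xs where xs: "xs \<noteq> []" "hd xs = a" "last xs = y" "distinct xs" "successively (adjacent F) xs"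
    by blast
  show ?case
  proof (cases "z \<in> set xs")
    case True
    then obtain ys zs where split: "xs = (ys @ [z]) @ zs"
      by (metis append.assoc append_Cons append_Nil split_list)
    with xs(5) have "successively (adjacent F) (ys @ [z])"
      by (metis successively_append_iff)
    with xs(2,4) split show ?thesis
      by (intro exI[of _ "ys @ [z]"]) (cases ys; simp)
  next
    case False
    with xs step.hyps(2) show ?thesis
      by (intro exI[of _ "xs @ [z]"]) (auto simp: successively_append_iff)
  qed
qed

lemma connected_imp_cycle:
  assumes "(adjacent F)\<^sup>*\<^sup>* a b" "a \<noteq> b" "{a, b} \<notin> F"
  shows "\<exists>C. is_cycle (insert {a, b} F) C"
proof -
  obtain xs where xs: "xs \<noteq> []" "hd xs = a" "last xs = b" "distinct xs" "successively (adjacent F) xs"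
    using connected_imp_distinct_path[OF assms(1)] by blast
  have succ: "{xs ! i, xs ! Suc i} \<in> F" if "Suc i < length xs" for i
    using xs(5) that by (simp add: successively_conv_nth)
  have ends: "xs ! 0 = a" "xs ! (length xs - 1) = b"
    using xs by (simp_all add: hd_conv_nth last_conv_nth)
  \<comment> \<open>One vertex would give \<open>a = b\<close>, and two would give the edge
    \<open>{a, b}\<close> in \<open>F\<close>.\<close>
  have "length xs \<noteq> 1" "length xs \<noteq> 2"
    using ends assms(2,3) succ[of 0] by auto
  then have len: "length xs \<ge> 3"
    using xs(1) by (cases "length xs") auto
  have "closed_walk_edges xs \<subseteq> insert {a, b} F"
  proof
    fix d assume "d \<in> closed_walk_edges xs"
    then obtain i where i: "i < length xs" "d = {xs ! i, xs ! (Suc i mod length xs)}"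
      by (auto simp: closed_walk_edges_def)
    show "d \<in> insert {a, b} F"
    proof (cases "Suc i = length xs")
      case True
      then have "i = length xs - 1"
        by simp
      with True i ends show ?thesis
        by (auto simp: insert_commute)
    next
      case False
      with i succ show ?thesis
        by auto
    qed
  qed
  with xs(4) len show ?thesis
    unfolding is_cycle_def by blast
qed

lemma forest_insert_not_connected:
  assumes "simple_graph (insert {a, b} F)" "{a, b} \<notin> F" "\<nexists>C. is_cycle (insert {a, b} F) C"
  shows "\<not> (adjacent F)\<^sup>*\<^sup>* a b"
  using assms connected_imp_cycle[of F a b] simple_graph_neq[of _ a b] by blast

text \<open>If the ends of a new edge have the same colour, flipping all colours in the component of
  \<open>a\<close> repairs this, since \<open>b\<close> lies in another component.\<close>

lemma forest_2_colourable:
  fixes F :: "'v::finite set set"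
  assumes "simple_graph F" "\<nexists>C. is_cycle F C"
  shows "\<exists>\<sigma> :: 'v \<Rightarrow> bool. \<forall>i j. {i, j} \<in> F \<longrightarrow> \<sigma> i \<noteq> \<sigma> j"
  using finite[of F] assms
proof (induction F rule: finite_induct)
  case (insert d F)
  obtain a b where d: "d = {a, b}"
    using simple_graph_edgeE[OF insert.prems(1), of d] by blast
  have nconn: "\<not> (adjacent F)\<^sup>*\<^sup>* a b"
    using insert d by (intro forest_insert_not_connected) auto
  have "simple_graph F" "\<nexists>C. is_cycle F C"
    using insert.prems is_cycle_mono[of F _ "insert d F"] by (auto simp: simple_graph_def)
  then obtain \<sigma> :: "'v \<Rightarrow> bool" where \<sigma>: "{i, j} \<in> F \<Longrightarrow> \<sigma> i \<noteq> \<sigma> j" for i j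
    using insert.IH by blast
  show ?case
  proof (cases "\<sigma> a = \<sigma> b")
    case False
    with \<sigma> show ?thesis
      by (intro exI[of _ \<sigma>]) (auto simp: d doubleton_eq_iff)
  next
    case True
    let ?conn = "(adjacent F)\<^sup>*\<^sup>* a"
    define \<tau> where "\<tau> i = (if ?conn i then \<not> \<sigma> i else \<sigma> i)" for i
    have "\<tau> i \<noteq> \<tau> j" if "{i, j} \<in> F" for i j
    proof -
      have "?conn i \<longleftrightarrow> ?conn j"
        using that rtranclp.rtrancl_into_rtrancl[of "adjacent F" a i j]
          rtranclp.rtrancl_into_rtrancl[of "adjacent F" a j i]
        by (auto simp: insert_commute)
      with \<sigma>[OF that] show ?thesis
        by (auto simp: \<tau>_def)
    qed
    moreover have "\<tau> a \<noteq> \<tau> b"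
      using nconn True by (simp add: \<tau>_def)
    ultimately show ?thesis
      by (intro exI[of _ \<tau>]) (auto simp: d doubleton_eq_iff)
  qed
qed simp

text \<open>Equal edges at different indices would make each index the cyclic successor of the
  other, impossible for length at least 3. Hence the number of edges of a cycle equals the length of
  its vertex list.\<close>

lemma inj_on_closed_walk:
  assumes "distinct vs" "length vs \<ge> 3"
  shows "inj_on (\<lambda>i. {vs ! i, vs ! (Suc i mod length vs)}) {..<length vs}"
proof (rule inj_onI)
  fix i j
  assume ij: "i \<in> {..<length vs}" "j \<in> {..<length vs}"
    and "{vs ! i, vs ! (Suc i mod length vs)} = {vs ! j, vs ! (Suc j mod length vs)}"
  moreover have "Suc i mod length vs < length vs" "Suc j mod length vs < length vs"
    using assms(2) by (intro mod_less_divisor; linarith)+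
  ultimately have "i = j \<or> (i = Suc j mod length vs \<and> Suc i mod length vs = j)"
    using assms(1) by (auto simp: doubleton_eq_iff nth_eq_iff_index_eq)
  then show "i = j"
  proof
    assume *: "i = Suc j mod length vs \<and> Suc i mod length vs = j"
    show "i = j"
    proof (cases "Suc j = length vs"; cases "Suc i = length vs")
    qed (use * ij assms(2) in auto)
  qed
qed

text \<open>Removing an edge of the only cycle leaves a forest. The rest of the cycle is a path of
  even length, along which colours alternate, so its ends agree in colour.\<close>

lemma odd_unicyclic_decompose:
  fixes E :: "'v::finite set set"
  assumes "odd_unicyclic E"
  obtains u v F and \<sigma> :: "'v \<Rightarrow> bool"
    where "E = insert {u, v} F" "{u, v} \<notin> F" "u \<noteq> v" "\<nexists>C. is_cycle F C"
      "\<And>i j. {i, j} \<in> F \<Longrightarrow> \<sigma> i \<noteq> \<sigma> j" "\<sigma> u = \<sigma> v"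
proof -
  have E: "simple_graph E" "\<exists>!C. is_cycle E C" and odd: "odd (card (THE C. is_cycle E C))"
    using assms by (auto simp: odd_unicyclic_def unicyclic_def)
  define C where "C = (THE C. is_cycle E C)"
  have C: "is_cycle E C"
    using E(2) unfolding C_def by (rule theI')
  then have C_unique: "C' = C" if "is_cycle E C'" for C'
    using E(2) that by blast
  from C obtain vs where vs: "distinct vs" "length vs \<ge> 3" "C = closed_walk_edges vs"
    by (auto simp: is_cycle_def)
  define n where "n = length vs"
  define e where "e i = {vs ! i, vs ! (Suc i mod n)}" for i
  have inj: "inj_on e {..<n}"
    using inj_on_closed_walk[OF vs(1,2)] by (simp add: inj_on_def e_def n_def)
  have C_e: "C = e ` {..<n}"
    by (simp add: vs(3) closed_walk_edges_def e_def n_def)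
  then have "card C = n"
    using inj by (simp add: card_image)
  with odd have n: "odd n" "n \<ge> 3"
    using vs(2) by (simp_all add: C_def n_def)
  \<comment> \<open>\<open>e (n - 1)\<close> is the wrap-around edge joining the last vertex to the
    first.\<close>
  define F where "F = E - {e (n - 1)}"
  have e_E: "e i \<in> E" if "i < n" for i
    using C that by (auto simp: is_cycle_def C_e)
  have e_F: "e i \<in> F" if "i < n - 1" for i
  proof -
    have "i < n"
      using that by simp
    then show ?thesis
      using that e_E[of i] inj_onD[OF inj, of i "n - 1"] by (auto simp: F_def)
  qed
  have last: "e (n - 1) = {vs ! (n - 1), vs ! 0}"
    using n(2) by (simp add: e_def)
  have no_cycle: "\<nexists>C'. is_cycle F C'"
  proof
    assume "\<exists>C'. is_cycle F C'"
    then obtain C' where C': "is_cycle F C'" ..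
    then have "C' = C"
      by (intro C_unique) (auto simp: is_cycle_def F_def)
    moreover have "e (n - 1) \<in> C"
      using n(2) by (simp add: C_e)
    ultimately show False
      using C' by (auto simp: is_cycle_def F_def)
  qed
  have simple_F: "simple_graph F"
    using E(1) by (simp add: simple_graph_def F_def)
  obtain \<sigma> :: "'v \<Rightarrow> bool" where \<sigma>: "{i, j} \<in> F \<Longrightarrow> \<sigma> i \<noteq> \<sigma> j" for i j
    using forest_2_colourable[OF simple_F no_cycle] by blast
  have "\<sigma> (vs ! i) = (\<sigma> (vs ! 0) \<longleftrightarrow> even i)" if "i < n" for i
    using that
  proof (induction i)
    case (Suc i)
    then have "{vs ! i, vs ! Suc i} \<in> F"
      using e_F[of i] by (simp add: e_def)
    with Suc \<sigma>[of "vs ! i" "vs ! Suc i"] show ?case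
      by auto
  qed simp
  from this[of "n - 1"] have "\<sigma> (vs ! (n - 1)) = \<sigma> (vs ! 0)"
    using n by simp
  moreover have "E = insert (e (n - 1)) F"
    using e_E[of "n - 1"] n(2) by (auto simp: F_def)
  moreover have "vs ! (n - 1) \<noteq> vs ! 0"
    using nth_eq_iff_index_eq[OF vs(1), of "n - 1" 0] n(2) by (cases "vs = []") (simp_all add: n_def)
  moreover have "e (n - 1) \<notin> F"
    by (simp add: F_def)
  ultimately show ?thesis
    using that[of "vs ! (n - 1)" "vs ! 0" F \<sigma>] no_cycle \<sigma> last by simp
qed

section \<open>Generation for forests and for odd unicyclic graphs\<close>

lemma selects_orders_subset: "selects_orders R E \<Longrightarrow> F \<subseteq> E \<Longrightarrow> selects_orders R F"
  unfolding selects_orders_def by blast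

text \<open>Edges may be added in any order: each joins two components, as otherwise a cycle would
  close. The colouring is chosen anew at each stage.\<close>

lemma forest_syzygies_generated:
  fixes F :: "'v::{finite,linorder} set set"
  assumes "simple_graph F" "\<nexists>C. is_cycle F C" "selects_orders R F"
  shows "first_syzygy F \<subseteq> (edge_module.span (syzygy_generators R F) :: ('v set \<Rightarrow> ('v, 'k::field) lss_ring) set)"
  using finite[of F] assms
proof (induction F rule: finite_induct)
  case empty
  have "c = 0" if "c \<in> first_syzygy {}" for c :: "'v set \<Rightarrow> ('v, 'k) lss_ring"
    using that by (auto simp: first_syzygy_def)
  then show ?case
    using edge_module.span_zero by blast
next
  case (insert d F)
  obtain a b where d: "d = {a, b}" "a \<noteq> b"
    using simple_graph_edgeE[OF insert.prems(1), of d] by blast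
  have nconn: "\<not> (adjacent F)\<^sup>*\<^sup>* a b"
    using insert d by (intro forest_insert_not_connected) auto
  have F: "simple_graph F" "\<nexists>C. is_cycle F C"
    using insert.prems is_cycle_mono[of F _ "insert d F"] by (auto simp: simple_graph_def)
  moreover have "selects_orders R F"
    using insert.prems(3) by (rule selects_orders_subset) blast
  ultimately have IH: "first_syzygy F \<subseteq> (edge_module.span (syzygy_generators R F) :: ('v set \<Rightarrow> ('v, 'k) lss_ring) set)"
    by (rule insert.IH)
  obtain \<sigma> :: "'v \<Rightarrow> bool" where \<sigma>: "{i, j} \<in> F \<Longrightarrow> \<sigma> i \<noteq> \<sigma> j" for i j
    using forest_2_colourable[OF F] by blast
  show ?case
    unfolding d(1)
    by (rule syzygies_generated_insert[where \<sigma> = \<sigma>]) (use insert d \<sigma> nconn IH in auto)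
qed

text \<open>Here the oddness of the cycle enters: the last edge joins connected vertices, but of
  equal colour.\<close>

lemma odd_unicyclic_span:
  fixes E :: "'v::{finite,linorder} set set"
  assumes "odd_unicyclic E" "selects_orders R E"
  shows "edge_module.span (syzygy_generators R E) = (first_syzygy E :: ('v set \<Rightarrow> ('v, 'k::field) lss_ring) set)"
proof
  have E: "simple_graph E"
    using assms(1) by (simp add: odd_unicyclic_def unicyclic_def)
  then show "edge_module.span (syzygy_generators R E) \<subseteq> (first_syzygy E :: ('v set \<Rightarrow> ('v, 'k) lss_ring) set)"
    by (rule span_syzygy_generators_subset)
  obtain u v F and \<sigma> :: "'v \<Rightarrow> bool"
    where F: "E = insert {u, v} F" "{u, v} \<notin> F" "u \<noteq> v" "\<nexists>C. is_cycle F C"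
      "\<And>i j. {i, j} \<in> F \<Longrightarrow> \<sigma> i \<noteq> \<sigma> j" "\<sigma> u = \<sigma> v"
    using odd_unicyclic_decompose[OF assms(1)] by metis
  have "first_syzygy F \<subseteq> (edge_module.span (syzygy_generators R F) :: ('v set \<Rightarrow> ('v, 'k) lss_ring) set)"
    by (rule forest_syzygies_generated)
      (use E F(1,4) assms(2) selects_orders_subset[of R E F] in \<open>auto simp: simple_graph_def\<close>)
  with E assms(2) F show "first_syzygy E \<subseteq> (edge_module.span (syzygy_generators R E) :: ('v set \<Rightarrow> ('v, 'k) lss_ring) set)"
    unfolding F(1) by (intro syzygies_generated_insert[where \<sigma> = \<sigma>]) auto
qed

section \<open>Minimality\<close>

definition total_degree :: "('a::finite \<Rightarrow>\<^sub>0 nat) \<Rightarrow> nat"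
  where "total_degree m = (\<Sum>t\<in>UNIV. Poly_Mapping.lookup m t)"

lemma total_degree_add: "total_degree (m + n) = total_degree m + total_degree n"
  by (simp add: total_degree_def lookup_add sum.distrib)

lemma total_degree_eq_0_iff: "total_degree m = 0 \<longleftrightarrow> m = 0"
  by (auto simp: total_degree_def intro: poly_mapping_eqI)

definition quadratic :: "('v::finite, 'k::field) lss_ring \<Rightarrow> bool"
  where "quadratic p \<longleftrightarrow> (\<forall>m\<in>Poly_Mapping.keys p. total_degree m = 2)"

lemma quadratic_0 [simp]: "quadratic 0"
  by (simp add: quadratic_def)

lemma quadratic_add: "quadratic p \<Longrightarrow> quadratic q \<Longrightarrow> quadratic (p + q)"
  using keys_add[of p q] by (auto simp: quadratic_def)

lemma quadratic_uminus: "quadratic p \<Longrightarrow> quadratic (- p)"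
  by (simp add: quadratic_def in_keys_iff)

lemma quadratic_diff: "quadratic p \<Longrightarrow> quadratic q \<Longrightarrow> quadratic (p - q)"
  using quadratic_add[of p "- q"] by (simp add: quadratic_uminus)

lemma quadratic_sign: "quadratic p \<Longrightarrow> quadratic ((- 1) ^ n * p)"
  by (cases "even n") (simp_all add: quadratic_uminus)

lemma quadratic_sum: "(\<And>a. a \<in> A \<Longrightarrow> quadratic (f a)) \<Longrightarrow> quadratic (sum f A)"
  by (induction A rule: infinite_finite_induct) (simp_all add: quadratic_add)

definition quadratic_monom :: "'a \<Rightarrow> 'a \<Rightarrow> ('a \<Rightarrow>\<^sub>0 nat)"
  where "quadratic_monom s t = Poly_Mapping.single s 1 + Poly_Mapping.single t 1"

lemma keys_quadratic_monom: "Poly_Mapping.keys (quadratic_monom s t) = {s, t}"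
  by (auto simp: quadratic_monom_def in_keys_iff lookup_add lookup_single when_def split: if_splits)

lemma quadratic_monom_eq_iff: "quadratic_monom s t = quadratic_monom s' t' \<longleftrightarrow> {s, t} = {s', t'}"
proof
  assume "{s, t} = {s', t'}"
  then show "quadratic_monom s t = quadratic_monom s' t'"
    by (auto simp: doubleton_eq_iff quadratic_monom_def add.commute)
qed (metis keys_quadratic_monom)

lemma total_degree_quadratic_monom: "total_degree (quadratic_monom s t) = 2"
proof -
  have "total_degree (Poly_Mapping.single s 1) = 1" for s :: 'a
    by (simp add: total_degree_def lookup_single when_def)
  then show ?thesis
    by (simp add: quadratic_monom_def total_degree_add)
qed

lemma indet_mult_indet: "indet s * indet t = Poly_Mapping.single (quadratic_monom s t) 1"
  by (simp add: indet_def mult_single quadratic_monom_def)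

lemma quadratic_indet_mult: "quadratic (indet s * indet t)"
  by (simp add: indet_mult_indet quadratic_def total_degree_quadratic_monom)

lemma lookup_indet_mult:
  "Poly_Mapping.lookup (indet s * indet t) (quadratic_monom s' t') = (if {s, t} = {s', t'} then 1 else 0)"
  by (simp add: indet_mult_indet lookup_single when_def quadratic_monom_eq_iff)

lemma quadratic_g_poly: "quadratic (g_poly d)"
  by (simp add: g_poly_def quadratic_add quadratic_indet_mult)

lemma quadratic_f_poly: "quadratic (f_poly d)"
  by (simp add: f_poly_def quadratic_diff quadratic_indet_mult)

text \<open>Only the constant term of \<open>p\<close> contributes in degree 2, every other term
  raising the degree of \<open>q\<close>.\<close>

lemma quadratic_mult_lookup:
  assumes q: "quadratic q" and m: "total_degree m = 2" and "Poly_Mapping.lookup q m = 0"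
  shows "Poly_Mapping.lookup (p * q) m = 0"
proof (induction p rule: poly_mapping_induct_single_add)
  case (1 n c)
  show ?case
  proof (cases "n = 0")
    case True
    have "Poly_Mapping.lookup (Poly_Mapping.map ((*) c) q) m = 0"
      by (simp add: Poly_Mapping.map.rep_eq assms(3))
    with True show ?thesis
      by (simp add: mult_map_scale_conv_mult)
  next
    case False
    then have "total_degree n \<noteq> 0"
      by (simp add: total_degree_eq_0_iff)
    have "m \<notin> Poly_Mapping.keys (Poly_Mapping.single n c * q)"
    proof
      assume "m \<in> Poly_Mapping.keys (Poly_Mapping.single n c * q)"
      then obtain m' where "m = n + m'" "m' \<in> Poly_Mapping.keys q"
        using keys_mult[of "Poly_Mapping.single n c" q] by (auto split: if_splits)
      with q m \<open>total_degree n \<noteq> 0\<close> show False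
        by (auto simp: quadratic_def total_degree_add)
    qed
    then show ?thesis
      by (simp add: in_keys_iff)
  qed
qed (simp add: distrib_right lookup_add)

lemma span_lookup_eq_0:
  assumes "c \<in> edge_module.span B"
    and B: "\<And>b. b \<in> B \<Longrightarrow> quadratic (b d) \<and> Poly_Mapping.lookup (b d) m = 0"
    and m: "total_degree m = 2"
  shows "Poly_Mapping.lookup (c d) m = 0"
  using assms(1)
proof (induction rule: edge_module.span_induct_alt)
  case (step p b c)
  then show ?case
    using B[OF step.hyps] m by (simp add: lookup_add scale_apply quadratic_mult_lookup)
qed simp

text \<open>The coefficient of a generator at its own coordinate and monomial is nonzero, but it
  vanishes on all other generators and, by homogeneity, on their whole span.\<close>

lemma minimally_generatesI:
  assumes span: "edge_module.span B = N"
    and quadratic: "\<And>b d. b \<in> B \<Longrightarrow> quadratic (b d)"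
    and dual: "\<And>b. b \<in> B \<Longrightarrow> \<exists>d m. total_degree m = 2 \<and> Poly_Mapping.lookup (b d) m \<noteq> 0
      \<and> (\<forall>b'\<in>B. Poly_Mapping.lookup (b' d) m \<noteq> 0 \<longrightarrow> b' = b)"
  shows "minimally_generates B N"
  unfolding minimally_generates_def
proof (intro conjI allI impI notI)
  fix B' assume B': "B' \<subset> B" and N: "edge_module.span B' = N"
  then obtain b where b: "b \<in> B" "b \<notin> B'"
    by blast
  then obtain d m where dm: "total_degree m = 2" "Poly_Mapping.lookup (b d) m \<noteq> 0"
      "\<forall>b'\<in>B. Poly_Mapping.lookup (b' d) m \<noteq> 0 \<longrightarrow> b' = b"
    using dual by blast
  have "b \<in> edge_module.span B'"
    using b(1) edge_module.span_base[of b B] by (simp add: span N)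
  then have "Poly_Mapping.lookup (b d) m = 0"
    by (rule span_lookup_eq_0) (use B' b(2) dm quadratic in blast)+
  with dm(2) show False
    by simp
qed (rule span)

text \<open>Monomials \<open>x_i x_j\<close> occur only in forms g and monomials
  \<open>x_i y_j\<close> only in forms f. The former detect Koszul syzygies, the latter
  claws.\<close>

lemma lookup_g_poly_XX:
  assumes "i \<noteq> j"
  shows "Poly_Mapping.lookup (g_poly {a, b}) (quadratic_monom (X i) (X j)) = (if {a, b} = {i, j} then 1 else 0)"
  by (simp add: g_pair lookup_add lookup_indet_mult doubleton_eq_iff)

lemma lookup_g_poly_XY:
  "Poly_Mapping.lookup (g_poly d) (quadratic_monom (X i) (Y j)) = 0"
  by (simp add: g_poly_def lookup_add lookup_indet_mult doubleton_eq_iff)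

lemma lookup_f_poly_XX:
  "Poly_Mapping.lookup (f_poly d) (quadratic_monom (X i) (X j)) = 0"
  by (simp add: f_poly_def lookup_minus lookup_indet_mult doubleton_eq_iff)

lemma lookup_f_poly_XY:
  assumes "i \<noteq> j" "a \<noteq> b"
  shows "Poly_Mapping.lookup (f_poly {a, b} :: ('v::{finite,linorder}, 'k::field) lss_ring)
    (quadratic_monom (X i) (Y j)) \<noteq> 0 \<longleftrightarrow> {a, b} = {i, j}"
  using assms
  by (auto simp: f_poly_minor minor_def lookup_minus lookup_indet_mult doubleton_eq_iff)

lemma lookup_sign:
  "Poly_Mapping.lookup ((- 1) ^ n * p) m = (- 1) ^ n * Poly_Mapping.lookup (p :: ('v, 'k::field) lss_ring) m"
  by (cases "even n") simp_all

text \<open>The claw syzygy as a function of the center and the leaf set, which removes the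
  ambiguity in the order of the leaves.\<close>

definition claw_element :: "'v::{finite,linorder} \<Rightarrow> 'v set \<Rightarrow> ('v set \<Rightarrow> ('v, 'k::field) lss_ring)"
  where "claw_element u L d =
    (\<Sum>a\<in>L. if d = {u, a} then (- 1) ^ position L a * f_poly (L - {a}) else 0)"

lemma claw_combination_eq:
  assumes "v \<noteq> w" "v \<noteq> z" "w \<noteq> z" "u \<notin> {v, w, z}"
  shows "claw_combination ({u, v, w, z} - {u}) u v w z = claw_element u {v, w, z}"
proof
  fix d
  have "{u, v, w, z} - {u} = {v, w, z}" "{v, w, z} - {v} = {z, w}" "{v, w, z} - {z} = {v, w}"
    "{v, w, z} - {w} = {v, z}"
    using assms by auto
  then show "claw_combination ({u, v, w, z} - {u}) u v w z d = claw_element u {v, w, z} d"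
    using assms by (simp add: claw_element_def claw_combination_apply ac_simps del: insert_Diff_single)
qed

lemma claw_syzygies_eq:
  fixes E :: "'v::{finite,linorder} set set"
  assumes E: "simple_graph E"
  shows "claw_syzygies E
    = ({claw_element u L | u L. card L = 3 \<and> (\<forall>a\<in>L. {u, a} \<in> E)} :: ('v set \<Rightarrow> ('v, 'k::field) lss_ring) set)"
    (is "_ = ?R")
proof (intro equalityI subsetI)
  fix c :: "'v set \<Rightarrow> ('v, 'k) lss_ring" assume "c \<in> claw_syzygies E"
  then obtain u v w z where c: "c = claw_combination ({u, v, w, z} - {u}) u v w z" "is_claw E u v w z"
    by (auto simp: claw_syzygies_def)
  then have claw: "v \<noteq> w" "v \<noteq> z" "w \<noteq> z" "{u, v} \<in> E" "{u, w} \<in> E" "{u, z} \<in> E"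
    by (auto simp: is_claw_def)
  then have "u \<notin> {v, w, z}"
    using E by (auto simp: simple_graph_def)
  then have "c = claw_element u {v, w, z}"
    using c claw claw_combination_eq by blast
  moreover have "card {v, w, z} = 3"
    using claw by simp
  ultimately show "c \<in> ?R"
    using claw by blast
next
  fix c assume "c \<in> ?R"
  then obtain u L where c: "c = claw_element u L" "card L = 3" "\<forall>a\<in>L. {u, a} \<in> E"
    by blast
  then obtain v w z where L: "L = {v, w, z}" "v \<noteq> w" "v \<noteq> z" "w \<noteq> z"
    by (auto simp: card_3_iff)
  with c have claw: "is_claw E u v w z"
    by (auto simp: is_claw_def)
  then have "u \<notin> {v, w, z}"
    using E by (auto simp: is_claw_def simple_graph_def)
  with c L have "c = claw_combination ({u, v, w, z} - {u}) u v w z"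
    using claw_combination_eq by metis
  with claw show "c \<in> claw_syzygies E"
    unfolding claw_syzygies_def by blast
qed

lemma lookup_claw_element_imp:
  assumes "Poly_Mapping.lookup (claw_element u L d :: ('v::{finite,linorder}, 'k::field) lss_ring) m \<noteq> 0"
  shows "\<exists>a\<in>L. d = {u, a} \<and> Poly_Mapping.lookup (f_poly (L - {a}) :: ('v, 'k) lss_ring) m \<noteq> 0"
proof (rule ccontr)
  assume "\<not> ?thesis"
  then have "Poly_Mapping.lookup (claw_element u L d :: ('v, 'k) lss_ring) m = 0"
    by (auto simp: claw_element_def lookup_sum lookup_sign intro!: sum.neutral)
  with assms show False
    by simp
qed

lemma triangle_is_cycle:
  assumes "{a, b} \<in> E" "{b, c} \<in> E" "{c, a} \<in> E" "a \<noteq> b" "b \<noteq> c" "c \<noteq> a"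
  shows "is_cycle E {{a, b}, {b, c}, {c, a}}"
proof -
  have lessThan_3: "{..<length [a, b, c]} = {0, 1, 2}"
    by auto
  have "closed_walk_edges [a, b, c] = {{a, b}, {b, c}, {c, a}}"
    unfolding closed_walk_edges_def lessThan_3 by simp
  then show ?thesis
    using assms unfolding is_cycle_def by (intro conjI exI[of _ "[a, b, c]"]) auto
qed

text \<open>Two triangles on a common edge would be two cycles. This excludes claws with centers
  \<open>u\<close> and \<open>v\<close> that share the edge \<open>{u, v}\<close> and the remaining
  leaves \<open>w\<close>, \<open>z\<close>, which would have the same coefficient there up to
  sign.\<close>

lemma unicyclic_no_diamond:
  assumes "unicyclic E" "w \<noteq> z" "{u, v} \<in> E" "{u, w} \<in> E" "{u, z} \<in> E" "{v, w} \<in> E" "{v, z} \<in> E"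
  shows False
proof -
  have ne: "u \<noteq> v" "u \<noteq> w" "u \<noteq> z" "v \<noteq> w" "v \<noteq> z"
    using assms by (auto simp: unicyclic_def simple_graph_def)
  have unique: "C = C'" if "is_cycle E C" "is_cycle E C'" for C C'
    using assms(1) that unfolding unicyclic_def by blast
  have edges: "{w, u} \<in> E" "{z, u} \<in> E"
    using assms by (simp_all add: insert_commute)
  have "is_cycle E {{u, v}, {v, w}, {w, u}}"
    by (rule triangle_is_cycle) (use assms edges ne in auto)
  moreover have "is_cycle E {{u, v}, {v, z}, {z, u}}"
    by (rule triangle_is_cycle) (use assms edges ne in auto)
  ultimately have "{{u, v}, {v, w}, {w, u}} = {{u, v}, {v, z}, {z, u}}"
    by (rule unique)
  moreover have "{v, w} \<in> {{u, v}, {v, w}, {w, u}}"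
    by simp
  ultimately have "{v, w} \<in> {{u, v}, {v, z}, {z, u}}"
    by simp
  with ne assms(2) show False
    by (auto simp: doubleton_eq_iff)
qed

theorem theorem5p4:
  fixes E :: "'v::{finite,linorder} set set"
    and R :: "('v set \<times> 'v set) set"
  assumes "odd_unicyclic E"
    and "selects_orders R E"
  shows "minimally_generates
    (koszul_syzygies R E \<union> claw_syzygies E)
    (first_syzygy E :: ('v set \<Rightarrow> ('v, 'k::field) lss_ring) set)"
proof (rule minimally_generatesI)
  have uni: "unicyclic E" and E: "simple_graph E"
    using assms(1) by (auto simp: odd_unicyclic_def unicyclic_def)
  show "edge_module.span (koszul_syzygies R E \<union> claw_syzygies E)
      = (first_syzygy E :: ('v set \<Rightarrow> ('v, 'k) lss_ring) set)"
    by (rule odd_unicyclic_span[OF assms])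
  fix b :: "'v set \<Rightarrow> ('v, 'k) lss_ring" assume "b \<in> koszul_syzygies R E \<union> claw_syzygies E"
  then consider d d' where "b = koszul d d'" "d \<in> E" "d' \<in> E" "d \<noteq> d'" "(d, d') \<in> R"
    | u L where "b = claw_element u L" "card L = 3" "\<forall>a\<in>L. {u, a} \<in> E"
    by (auto simp: koszul_syzygies_def claw_syzygies_eq[OF E])
  note b_cases = this
  show "quadratic (b d)" for d
    using b_cases by cases
      (auto simp: koszul_apply claw_element_def
        intro!: quadratic_diff quadratic_uminus quadratic_sum quadratic_sign quadratic_g_poly quadratic_f_poly)
  show "\<exists>d m. total_degree m = 2 \<and> Poly_Mapping.lookup (b d) m \<noteq> 0
      \<and> (\<forall>b'\<in>koszul_syzygies R E \<union> claw_syzygies E. Poly_Mapping.lookup (b' d) m \<noteq> 0 \<longrightarrow> b' = b)"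
    using b_cases
  proof cases
    case (1 d d')
    obtain i j where ij: "d = {i, j}" "i \<noteq> j"
      using simple_graph_edgeE[OF E 1(2)] by blast
    \<comment> \<open>The coefficient of \<open>koszul d d'\<close> at \<open>d'\<close> is the form
      g of \<open>d\<close>, the only form g of an edge that contains this monomial.\<close>
    let ?m = "quadratic_monom (X i) (X j)"
    have g: "Poly_Mapping.lookup (g_poly e :: ('v, 'k) lss_ring) ?m = (if e = d then 1 else 0)" if "e \<in> E" for e
      using simple_graph_edgeE[OF E that] lookup_g_poly_XX[OF ij(2)] ij(1) by metis
    have "b' = b" if "b' \<in> koszul_syzygies R E \<union> claw_syzygies E"
      and nz: "Poly_Mapping.lookup (b' d') ?m \<noteq> 0" for b' :: "'v set \<Rightarrow> ('v, 'k) lss_ring"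
    proof -
      from that(1) consider d1 d2 where "b' = koszul d1 d2" "d1 \<in> E" "d2 \<in> E" "d1 \<noteq> d2" "(d1, d2) \<in> R"
        | u L where "b' = claw_element u L"
        by (auto simp: koszul_syzygies_def claw_syzygies_eq[OF E])
      then show ?thesis
      proof cases
        case d12: 1
        then have "(d1 = d \<and> d2 = d') \<or> (d2 = d \<and> d1 = d')"
          \<comment> \<open>The swapped pair has the same monomial at \<open>d'\<close>; it is ruled
            out below because \<open>R\<close> contains only one of the two orders.\<close>
          using nz by (auto simp: koszul_apply lookup_minus g split: if_splits)
        moreover have "(d', d) \<notin> R"
          using assms(2) 1 unfolding selects_orders_def by blast
        ultimately show ?thesis
          using 1 d12 by blast
      next
        case 2
        with nz show ?thesis
          using lookup_claw_element_imp lookup_f_poly_XX by metis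
      qed
    qed
    moreover have "Poly_Mapping.lookup (b d') ?m \<noteq> 0"
      using 1 by (simp add: koszul_apply g)
    ultimately show ?thesis
      using total_degree_quadratic_monom by blast
  next
    case (2 u L)
    then obtain v w z where L: "L = {v, w, z}" "v \<noteq> w" "v \<noteq> z" "w \<noteq> z"
      by (auto simp: card_3_iff)
    then have edges: "{u, v} \<in> E" "{u, w} \<in> E" "{u, z} \<in> E"
      using 2 by auto
    have Lv: "L - {v} = {w, z}"
      using L by auto
    \<comment> \<open>At \<open>{u, v}\<close> the claw has the form f of the two other leaves
      \<open>w\<close>, \<open>z\<close>, up to sign.\<close>
    let ?m = "quadratic_monom (X w) (Y z)"
    have f: "Poly_Mapping.lookup (f_poly {p, q} :: ('v, 'k) lss_ring) ?m \<noteq> 0 \<longleftrightarrow> {p, q} = {w, z}"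
      if "p \<noteq> q" for p q
      using lookup_f_poly_XY[OF L(4) that] .
    have "b' = b" if "b' \<in> koszul_syzygies R E \<union> claw_syzygies E"
      and nz: "Poly_Mapping.lookup (b' {u, v}) ?m \<noteq> 0" for b' :: "'v set \<Rightarrow> ('v, 'k) lss_ring"
    proof -
      from that(1) consider d1 d2 where "b' = koszul d1 d2"
        | u' L' where "b' = claw_element u' L'" "card L' = 3" "\<forall>a\<in>L'. {u', a} \<in> E"
        by (auto simp: koszul_syzygies_def claw_syzygies_eq[OF E])
      then show ?thesis
      proof cases
        case 1
        with nz show ?thesis
          by (simp add: koszul_apply lookup_minus lookup_g_poly_XY split: if_splits)
      next
        case L': (2 u' L')
        then obtain a where a: "a \<in> L'" "{u, v} = {u', a}"
            "Poly_Mapping.lookup (f_poly (L' - {a}) :: ('v, 'k) lss_ring) ?m \<noteq> 0"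
          using lookup_claw_element_imp[of u' L' "{u, v}" ?m] nz by blast
        have "card (L' - {a}) = 2"
          using L'(2) a(1) by simp
        then obtain p q where "L' - {a} = {p, q}" "p \<noteq> q"
          by (auto simp: card_2_iff)
        then have "L' - {a} = {w, z}"
          using a(3) f by metis
        then have L'_eq: "L' = {a, w, z}"
          using a(1) by blast
        \<comment> \<open>Otherwise the roles are exchanged, with center \<open>v\<close> and leaf
          \<open>u\<close>, which gives the excluded pair of triangles.\<close>
        have "u' = u \<and> a = v"
        proof (rule ccontr)
          assume "\<not> ?thesis"
          with a(2) have "u' = v"
            by (auto simp: doubleton_eq_iff)
          with L'(3) L'_eq have "{v, w} \<in> E" "{v, z} \<in> E"
            by auto
          with uni L(4) edges show False
            by (rule unicyclic_no_diamond)
        qed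
        then show ?thesis
          using 2(1) L'(1) L'_eq L(1) by simp
      qed
    qed
    moreover have "Poly_Mapping.lookup (b {u, v}) ?m \<noteq> 0"
    proof -
      have "u \<noteq> v"
        using E edges(1) by (rule simple_graph_neq)
      then have "claw_element u L {u, v} = (- 1) ^ position L v * (f_poly (L - {v}) :: ('v, 'k) lss_ring)"
        using L by (simp add: claw_element_def doubleton_eq_iff)
      then show ?thesis
        using f[OF L(4)] by (simp add: 2(1) lookup_sign Lv)
    qed
    ultimately show ?thesis
      using total_degree_quadratic_monom by blast
  qed
qed

end
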